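(* Let $G=(V,E)$ be a connected graph on $V=\{1,\dots,p\}$, $p\ge3$. Let $\mathbf{A}\in\mathbb{R}^{n\times p}$ have i.i.d. rows $\mathbf{a}_i/\sqrt{n}$, where $\mathrm{Cov}[\mathbf{a}_i]=\mathbf{\Sigma}$ and $\|\mathbf{a}_i\|_{\psi_2}\le K$. Suppose that the largest and smallest eigenvalues of $\mathbf{\Sigma}$ satisfy $\sigma_{\max}(\mathbf{\Sigma})\le(1+\kappa)^2$ and $\sigma_{\min}(\mathbf{\Sigma})\ge(1-\kappa)^2$ for a constant $\kappa\in(0,1)$. Then for any $k>0$ and some constant $C>0$ depending only on $K,\kappa,k$, with probability at least $1-|E|^{-k}$, the matrix $\mathbf{A}$ satisfies the $(\kappa,\rho)$-cut-restricted isometry property for the function $$\rho(s)=\frac{Cs\log(1+|E|/s)}{n}.$$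
   Context: Gradient sparsity: for a graph $G=(V,E)$ with $V=\{1,\dots,p\}$ and undirected edge set $E$, $\nabla\mathbf{x}=(x_i-x_j:(i,j)\in E)\in\mathbb{R}^{|E|}$ (with an arbitrary fixed ordering of each edge's endpoints), so $\|\nabla\mathbf{x}\|_0=\#\{(i,j)\in E: x_i\ne x_j\}$. Cut-restricted isometry property (cRIP): let $\kappa>0$ and let $\rho:[0,\infty)\to[0,\infty)$ be any function satisfying $\rho'(s)\ge 0$ and $\rho''(s)\le 0$ for all $s>0$. A matrix $\mathbf{A}\in\mathbb{R}^{n\times p}$ satisfies $(\kappa,\rho)$-cRIP if for every $\mathbf{x}\in\mathbb{R}^p$ with $\|\nabla\mathbf{x}\|_0\ge 1$, $$\left(1-\kappa-\sqrt{\rho(\|\nabla\mathbf{x}\|_0)}\right)\|\mathbf{x}\|_2\le\|\mathbf{A}\mathbf{x}\|_2\le\left(1+\kappa+\sqrt{\rho(\|\nabla\mathbf{x}\|_0)}\right)\|\mathbf{x}\|_2 .$$ The function $\rho(s)=Cs\log(1+|E|/s)/n$ is understood to equal $0$ at $s=0$. Sub-Gaussian norm of a random vector $\mathbf{a}$: $\|\mathbf{a}\|_{\psi_2}=\sup_{\mathbf{u}:\|\mathbf{u}\|_2=1}\sup_{q\ge1}q^{-1/2}\,\mathbb{E}\big[|\mathbf{u}^{\mathsf T}\mathbf{a}|^q\big]^{1/q}$; here $K>0$ is a constant.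
   Formalization: The rows a_i are additionally assumed to have mean zero, without which the claim fails (a nonzero mean inflates ‖Ax‖ as n grows); C is stated per type of sample space, and passing to the law of the rows gives one C for all. *)

theory Defs
  imports
    "HOL-Probability.Probability"
    "Jordan_Normal_Form.Spectral_Radius"
begin

hide_const (open) Finite_Cartesian_Product.vec Finite_Cartesian_Product.mat
no_notation Finite_Cartesian_Product.vec_nth (infixl \<open>$\<close> 90)

text \<open>
  The dimensions \<open>n\<close> and \<open>p\<close> are term-level naturals, so that a constant can be quantified
  before them. Indices and vertices start at 0: the vertex set is \<open>{..<p}\<close>.
\<close>

definition l2_norm :: "real vec \<Rightarrow> real" where
  "l2_norm x = L2_set (\<lambda>i. x $ i) {..<dim_vec x}"

subsection \<open>Graphs and gradient sparsity\<close>

text \<open>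
  A finite simple undirected graph is given by an arbitrary orientation of its edges: each edge
  occurs in \<open>E\<close> as exactly one ordered pair, so \<open>card E\<close> counts undirected edges. The
  asymmetry condition excludes loops.
\<close>

definition simple_graph :: "nat \<Rightarrow> (nat \<times> nat) set \<Rightarrow> bool" where
  "simple_graph p E \<longleftrightarrow> E \<subseteq> {..<p} \<times> {..<p} \<and> (\<forall>i j. (i, j) \<in> E \<longrightarrow> (j, i) \<notin> E)"

definition connected_graph :: "nat \<Rightarrow> (nat \<times> nat) set \<Rightarrow> bool" where
  "connected_graph p E \<longleftrightarrow> simple_graph p E \<and> (\<forall>u<p. \<forall>v<p. (u, v) \<in> (E \<union> E\<inverse>)\<^sup>*)"

definition grad :: "real vec \<Rightarrow> nat \<times> nat \<Rightarrow> real" where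
  "grad x = (\<lambda>(i, j). x $ i - x $ j)"

definition grad_l0 :: "(nat \<times> nat) set \<Rightarrow> real vec \<Rightarrow> nat" where
  "grad_l0 E x = card {e \<in> E. grad x e \<noteq> 0}"

subsection \<open>The cut-restricted isometry property\<close>

text \<open>Only the values of \<open>\<rho>\<close> on \<open>[0, \<infinity>)\<close> are constrained.\<close>

definition crip_function :: "(real \<Rightarrow> real) \<Rightarrow> bool" where
  "crip_function \<rho> \<longleftrightarrow>
     (\<forall>s\<ge>0. \<rho> s \<ge> 0) \<and>
     (\<exists>\<rho>' \<rho>''. \<forall>s>0.
        (\<rho> has_real_derivative \<rho>' s) (at s) \<and> (\<rho>' has_real_derivative \<rho>'' s) (at s) \<and>
        \<rho>' s \<ge> 0 \<and> \<rho>'' s \<le> 0)"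

definition cRIP ::
  "nat \<Rightarrow> nat \<Rightarrow> (nat \<times> nat) set \<Rightarrow> real \<Rightarrow> (real \<Rightarrow> real) \<Rightarrow> real mat \<Rightarrow> bool" where
  "cRIP n p E \<kappa> \<rho> A \<longleftrightarrow>
     \<kappa> > 0 \<and> crip_function \<rho> \<and> A \<in> carrier_mat n p \<and>
     (\<forall>x \<in> carrier_vec p. grad_l0 E x \<ge> 1 \<longrightarrow>
        (1 - \<kappa> - sqrt (\<rho> (real (grad_l0 E x)))) * l2_norm x \<le> l2_norm (A *\<^sub>v x) \<and>
        l2_norm (A *\<^sub>v x) \<le> (1 + \<kappa> + sqrt (\<rho> (real (grad_l0 E x)))) * l2_norm x)"

subsection \<open>Random vectors and random matrices\<close>

text \<open>
  A random vector in \<open>\<real>\<^sup>p\<close> is a measurable map into the product Borel space below.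
\<close>

abbreviation borel_vec :: "nat \<Rightarrow> (nat \<Rightarrow> real) measure" where
  "borel_vec p \<equiv> PiM {..<p} (\<lambda>_. borel)"

definition iid_vectors :: "'w measure \<Rightarrow> nat \<Rightarrow> nat \<Rightarrow> (nat \<Rightarrow> 'w \<Rightarrow> nat \<Rightarrow> real) \<Rightarrow> bool" where
  "iid_vectors M n p a \<longleftrightarrow>
     prob_space.indep_vars M (\<lambda>_. borel_vec p) a {..<n} \<and>
     (\<forall>i<n. \<forall>j<n. distr M (borel_vec p) (a i) = distr M (borel_vec p) (a j))"

text \<open>
  Centering is essential when the spectrum of the covariance matrix is to control \<open>\<parallel>A x\<parallel>\<close>:
  for a nonzero mean \<open>\<mu>\<close> the second moment of \<open>x \<bullet> X\<close> exceeds its variance by \<open>(x \<bullet> \<mu>)\<^sup>2\<close>.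
\<close>

definition mean_zero :: "'w measure \<Rightarrow> nat \<Rightarrow> ('w \<Rightarrow> nat \<Rightarrow> real) \<Rightarrow> bool" where
  "mean_zero M p X \<longleftrightarrow> (\<forall>j<p. integrable M (\<lambda>w. X w j) \<and> (\<integral>w. X w j \<partial>M) = 0)"

definition cov_mat :: "'w measure \<Rightarrow> nat \<Rightarrow> ('w \<Rightarrow> nat \<Rightarrow> real) \<Rightarrow> real mat" where
  "cov_mat M p X = mat p p (\<lambda>(i, j).
     \<integral>w. (X w i - (\<integral>v. X v i \<partial>M)) * (X w j - (\<integral>v. X v j \<partial>M)) \<partial>M)"

text \<open>
  \<open>Lq_norm M q Y\<close> is \<open>E[\<bar>Y\<bar>\<^sup>q]\<close> to the power \<open>1/q\<close>, with value \<open>\<infinity>\<close> if the moment is not finite.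
\<close>

definition Lq_norm :: "'w measure \<Rightarrow> real \<Rightarrow> ('w \<Rightarrow> real) \<Rightarrow> ereal" where
  "Lq_norm M q Y =
     (if integrable M (\<lambda>w. \<bar>Y w\<bar> powr q)
      then ereal ((\<integral>w. \<bar>Y w\<bar> powr q \<partial>M) powr (1 / q)) else \<infinity>)"

definition psi2_norm :: "'w measure \<Rightarrow> nat \<Rightarrow> ('w \<Rightarrow> nat \<Rightarrow> real) \<Rightarrow> ereal" where
  "psi2_norm M p X =
     (SUP u \<in> {u \<in> carrier_vec p. l2_norm u = 1}. SUP q \<in> {1..}.
        ereal (q powr (- 1 / 2)) * Lq_norm M q (\<lambda>w. u \<bullet> vec p (X w)))"

definition row_matrix :: "nat \<Rightarrow> nat \<Rightarrow> (nat \<Rightarrow> 'w \<Rightarrow> nat \<Rightarrow> real) \<Rightarrow> 'w \<Rightarrow> real mat" where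
  "row_matrix n p a w = mat n p (\<lambda>(i, j). a i w j / sqrt (real n))"

text \<open>Intended for symmetric matrices of positive dimension, whose real spectrum is nonempty.\<close>

definition sigma_max :: "real mat \<Rightarrow> real" where
  "sigma_max S = Max (spectrum S)"

definition sigma_min :: "real mat \<Rightarrow> real" where
  "sigma_min S = Min (spectrum S)"

text \<open>At \<open>s = 0\<close> this evaluates to 0, since \<open>C * 0 = 0\<close>.\<close>

definition rho_log :: "real \<Rightarrow> nat \<Rightarrow> (nat \<times> nat) set \<Rightarrow> real \<Rightarrow> real" where
  "rho_log C n E s = C * s * ln (1 + real (card E) / s) / real n"

end

theory Submission
  imports Defs
begin

text \<open>
  Write \<open>\<parallel>A x\<parallel>\<^sup>2 = x\<^sup>T \<Sigma> x + x\<^sup>T D x\<close> with \<open>D = A\<^sup>T A - \<Sigma>\<close>. The eigenvalue bounds control the first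
  term, so it suffices that \<open>\<bar>x\<^sup>T D x\<bar>\<close> is at most of order \<open>max (sqrt b) b * \<parallel>x\<parallel>\<^sup>2\<close> with
  \<open>n * b\<close> a multiple of \<open>s * ln (1 + |E| / s)\<close>, simultaneously for all \<open>x\<close> whose cut has
  \<open>s\<close> edges. For a fixed \<open>x\<close> this is Bernstein's inequality for the subexponential
  variables \<open>(x \<bullet> a\<^sub>i)\<^sup>2\<close>. If \<open>F\<close> is the cut of \<open>x\<close>, then every vertex is joined within \<open>E - F\<close> to
  vertex 0 or to an endpoint of an edge of \<open>F\<close>, so \<open>x\<close> lies in a space of vectors constant on at most
  \<open>2 s + 1\<close> blocks that is determined by \<open>F\<close>. The unit ball of this space has a net of
  size exponential in \<open>s\<close>, and there are at most \<open>(e |E| / s)\<^sup>s\<close> cuts with \<open>s\<close> edges, so the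
  union bound closes.
\<close>

subsection \<open>Concentration of sums of squared sub-Gaussian variables\<close>

text \<open>The left side is one term of the series of \<open>exp n\<close>. The bound turns moments
  of order q^q into a geometric series after division by q!, and later controls binomial
  coefficients.\<close>

lemma power_div_fact_le: "real n ^ n / fact n \<le> exp 1 ^ n"
proof -
  have "(\<Sum>k\<in>{n}. real n ^ k / fact k) \<le> (\<Sum>k. real n ^ k / fact k)"
    using summable_exp[of "real n"] by (intro sum_le_suminf) (auto simp: field_simps)
  also have "\<dots> = exp (real n)"
    by (simp add: exp_def divide_inverse mult.commute)
  also have "\<dots> = exp 1 ^ n"
    by (simp flip: exp_of_nat_mult)
  finally show ?thesis by simp
qed

text \<open>The linear term keeps its sign, so that it vanishes in expectation for a centred
  variable; only the terms of order at least 2 are replaced by their absolute values.\<close>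

lemma exp_le_linear_plus_tail:
  fixes y :: real
  shows "exp y \<le> 1 + y + (exp \<bar>y\<bar> - 1 - \<bar>y\<bar>)"
proof -
  define t where "t = (\<lambda>z::real. \<Sum>n. inverse (fact (n + 2)) * z ^ (n + 2))"
  have t: "exp z = 1 + z + t z" for z :: real
    unfolding t_def using exp_first_two_terms[of z] by simp
  have s: "summable (\<lambda>n. inverse (fact (n + 2)) * z ^ (n + 2))" for z :: real
    using summable_ignore_initial_segment[OF summable_exp[of z], of 2] by simp
  have "t y \<le> t \<bar>y\<bar>"
    unfolding t_def
  proof (intro suminf_le s)
    show "inverse (fact (n + 2)) * y ^ (n + 2) \<le> inverse (fact (n + 2)) * \<bar>y\<bar> ^ (n + 2)" for n
      using abs_ge_self[of "y ^ (n + 2)"] by (intro mult_left_mono) (auto simp only: power_abs, simp)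
  qed
  then show ?thesis using t[of y] t[of "\<bar>y\<bar>"] by simp
qed

context prob_space
begin

text \<open>Moments of order q^q divided by q! leave a geometric series with ratio \<theta> at most
  1/2. Centring removes the linear term, so the series starts at \<theta>^2 and the bound is of
  Gaussian type for small \<open>l\<close>.\<close>

lemma nn_integral_exp_centred_square_le:
  fixes Y :: "'a \<Rightarrow> real"
  assumes Y[measurable]: "Y \<in> borel_measurable M"
    and int: "\<And>q::nat. q \<ge> 1 \<Longrightarrow> integrable M (\<lambda>w. Y w ^ (2 * q))"
    and mom: "\<And>q::nat. q \<ge> 1 \<Longrightarrow> expectation (\<lambda>w. Y w ^ (2 * q)) \<le> (2 * K\<^sup>2 * real q) ^ q"
    and l: "2 * exp 1 * K\<^sup>2 * \<bar>l\<bar> \<le> 1 / 2"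
  shows "(\<integral>\<^sup>+w. ennreal (exp (l * ((Y w)\<^sup>2 - expectation (\<lambda>w. (Y w)\<^sup>2)))) \<partial>M)
    \<le> ennreal (exp (4 * (2 * exp 1 * K\<^sup>2 * l)\<^sup>2))"
proof -
  define \<mu> where "\<mu> = expectation (\<lambda>w. (Y w)\<^sup>2)"
  define Z where "Z = (\<lambda>w. (Y w)\<^sup>2 - \<mu>)"
  define \<theta> where "\<theta> = 2 * exp 1 * K\<^sup>2 * \<bar>l\<bar>"
  define g where "g = (\<lambda>w. exp \<bar>l * Z w\<bar> - 1 - \<bar>l * Z w\<bar>)"
  have \<theta>: "0 \<le> \<theta>" "\<theta> \<le> 1 / 2" using l by (auto simp: \<theta>_def)
  have [measurable]: "Z \<in> borel_measurable M" by (simp add: Z_def)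
  have [measurable]: "g \<in> borel_measurable M" by (simp add: g_def)
  have int2: "integrable M (\<lambda>w. (Y w)\<^sup>2)" using int[of 1] by simp
  have mu: "0 \<le> \<mu>" "\<mu> \<le> 2 * K\<^sup>2"
    using mom[of 1] by (auto simp: \<mu>_def)
  have Zpow: "(\<integral>\<^sup>+w. ennreal (\<bar>Z w\<bar> ^ q) \<partial>M) \<le> ennreal (2 * (2 * K\<^sup>2 * real q) ^ q)" if q: "q \<ge> 1" for q
  proof -
    have "(\<integral>\<^sup>+w. ennreal (\<bar>Z w\<bar> ^ q) \<partial>M) \<le> (\<integral>\<^sup>+w. ennreal (Y w ^ (2 * q) + \<mu> ^ q) \<partial>M)"
    proof (intro nn_integral_mono ennreal_leI)
      fix w
      \<comment> \<open>Both the square and its mean are nonnegative, so the difference is at most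
        the larger one. This avoids the factor 2^q from the power of a sum.\<close>
      have "\<bar>Z w\<bar> \<le> max ((Y w)\<^sup>2) \<mu>" using mu(1) zero_le_power2[of "Y w"] unfolding Z_def by linarith
      then have "\<bar>Z w\<bar> ^ q \<le> (max ((Y w)\<^sup>2) \<mu>) ^ q" by (intro power_mono) auto
      also have "\<dots> \<le> ((Y w)\<^sup>2) ^ q + \<mu> ^ q" using mu(1) by (auto simp: max_def)
      finally show "\<bar>Z w\<bar> ^ q \<le> Y w ^ (2 * q) + \<mu> ^ q" by (simp add: power_mult)
    qed
    also have "\<dots> = ennreal (expectation (\<lambda>w. Y w ^ (2 * q) + \<mu> ^ q))"
      using int[OF q] mu by (intro nn_integral_eq_integral) (auto simp: power_mult)
    also have "expectation (\<lambda>w. Y w ^ (2 * q) + \<mu> ^ q) = expectation (\<lambda>w. Y w ^ (2 * q)) + \<mu> ^ q"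
      using int[OF q] by (simp add: prob_space)
    also have "ennreal \<dots> \<le> ennreal (2 * (2 * K\<^sup>2 * real q) ^ q)"
    proof (rule ennreal_leI)
      have "1 * (2 * K\<^sup>2) \<le> real q * (2 * K\<^sup>2)" using q by (intro mult_right_mono) auto
      then have "\<mu> \<le> 2 * K\<^sup>2 * real q" using mu(2) by (simp add: mult.commute)
      then have "\<mu> ^ q \<le> (2 * K\<^sup>2 * real q) ^ q" using mu by (intro power_mono)
      then show "expectation (\<lambda>w. Y w ^ (2 * q)) + \<mu> ^ q \<le> 2 * (2 * K\<^sup>2 * real q) ^ q"
        using mom[OF q] by simp
    qed
    finally show ?thesis .
  qed
  have trm: "(\<integral>\<^sup>+w. ennreal (\<bar>l * Z w\<bar> ^ q / fact q) \<partial>M) \<le> ennreal (2 * \<theta> ^ q)" if q: "q \<ge> 1" for q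
  proof -
    have "(\<integral>\<^sup>+w. ennreal (\<bar>l * Z w\<bar> ^ q / fact q) \<partial>M)
        = (\<integral>\<^sup>+w. ennreal (\<bar>l\<bar> ^ q / fact q) * ennreal (\<bar>Z w\<bar> ^ q) \<partial>M)"
      by (intro nn_integral_cong) (auto simp: abs_mult power_mult_distrib simp flip: ennreal_mult)
    also have "\<dots> = ennreal (\<bar>l\<bar> ^ q / fact q) * (\<integral>\<^sup>+w. ennreal (\<bar>Z w\<bar> ^ q) \<partial>M)"
      by (rule nn_integral_cmult) measurable
    also have "\<dots> \<le> ennreal (\<bar>l\<bar> ^ q / fact q) * ennreal (2 * (2 * K\<^sup>2 * real q) ^ q)"
      by (intro mult_left_mono Zpow q) auto
    also have "\<dots> = ennreal (\<bar>l\<bar> ^ q / fact q * (2 * (2 * K\<^sup>2 * real q) ^ q))"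
      by (simp flip: ennreal_mult)
    also have "\<bar>l\<bar> ^ q / fact q * (2 * (2 * K\<^sup>2 * real q) ^ q)
        = 2 * (2 * K\<^sup>2 * \<bar>l\<bar>) ^ q * (real q ^ q / fact q)"
      by (simp add: power_mult_distrib)
    also have "ennreal \<dots> \<le> ennreal (2 * (2 * K\<^sup>2 * \<bar>l\<bar>) ^ q * exp 1 ^ q)"
      by (intro ennreal_leI mult_left_mono power_div_fact_le) auto
    also have "2 * (2 * K\<^sup>2 * \<bar>l\<bar>) ^ q * exp 1 ^ q = 2 * \<theta> ^ q"
      by (simp add: \<theta>_def power_mult_distrib)
    finally show ?thesis .
  qed
  have tail: "(\<lambda>q. \<bar>y\<bar> ^ (q + 2) / fact (q + 2)) sums (exp \<bar>y\<bar> - 1 - \<bar>y\<bar>)" for y :: real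
  proof -
    have "(\<lambda>n. \<bar>y\<bar> ^ n / fact n) sums exp \<bar>y\<bar>"
      using exp_converges[of "\<bar>y\<bar>"] by (simp add: field_simps)
    from sums_split_initial_segment[OF this, of 2] show ?thesis
      by (simp add: lessThan_nat_numeral algebra_simps)
  qed
  have g0: "g w \<ge> 0" for w
    using exp_ge_add_one_self[of "\<bar>l * Z w\<bar>"] unfolding g_def by linarith
  \<comment> \<open>All terms are nonnegative, so the series is integrated term by term before
    \<open>g\<close> is known to be integrable; integrability then follows from the finite
    value.\<close>
  have gs: "ennreal (g w) = (\<Sum>q. ennreal (\<bar>l * Z w\<bar> ^ (q + 2) / fact (q + 2)))" for w
    using tail[of "l * Z w"] by (subst suminf_ennreal2) (auto simp: g_def sums_iff)
  have "(\<integral>\<^sup>+w. ennreal (g w) \<partial>M) = (\<Sum>q. \<integral>\<^sup>+w. ennreal (\<bar>l * Z w\<bar> ^ (q + 2) / fact (q + 2)) \<partial>M)"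
    unfolding gs by (rule nn_integral_suminf) measurable
  also have "\<dots> \<le> (\<Sum>q. ennreal (2 * \<theta> ^ (q + 2)))"
    by (intro suminf_le trm) auto
  also have "\<dots> = ennreal (\<Sum>q. 2 * \<theta>\<^sup>2 * \<theta> ^ q)"
    using \<theta> by (subst suminf_ennreal2)
      (auto simp: power_add power2_eq_square mult_ac intro!: summable_mult summable_geometric)
  also have "(\<Sum>q. 2 * \<theta>\<^sup>2 * \<theta> ^ q) = 2 * \<theta>\<^sup>2 * (1 / (1 - \<theta>))"
    using \<theta> by (subst suminf_mult) (auto simp: suminf_geometric intro: summable_geometric)
  also have "ennreal \<dots> \<le> ennreal (2 * \<theta>\<^sup>2 * 2)"
    using \<theta> by (intro ennreal_leI mult_left_mono) (auto simp: field_simps)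
  finally have gi: "(\<integral>\<^sup>+w. ennreal (g w) \<partial>M) \<le> ennreal (4 * \<theta>\<^sup>2)" by simp
  have gint: "integrable M g"
    by (rule integrableI_nonneg) (use gi g0 in \<open>auto intro: le_less_trans\<close>)
  have gE: "expectation g \<le> 4 * \<theta>\<^sup>2"
    using gi g0 by (subst (asm) nn_integral_eq_integral[OF gint]) auto
  have Zint: "integrable M Z" using int2 by (simp add: Z_def)
  have ZE: "expectation Z = 0" using int2 by (simp add: Z_def \<mu>_def prob_space)
  have le: "exp (l * Z w) \<le> 1 + l * Z w + g w" for w
    using exp_le_linear_plus_tail[of "l * Z w"] by (simp add: g_def)
  have "(\<integral>\<^sup>+w. ennreal (exp (l * Z w)) \<partial>M) \<le> (\<integral>\<^sup>+w. ennreal (1 + l * Z w + g w) \<partial>M)"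
    by (intro nn_integral_mono ennreal_leI le)
  also have "\<dots> = ennreal (expectation (\<lambda>w. 1 + l * Z w + g w))"
    using Zint gint le by (intro nn_integral_eq_integral) (auto intro: order_trans[OF exp_ge_zero])
  also have "expectation (\<lambda>w. 1 + l * Z w + g w) = 1 + expectation g"
    using Zint gint ZE by (simp add: prob_space)
  also have "ennreal \<dots> \<le> ennreal (exp (4 * \<theta>\<^sup>2))"
    using gE exp_ge_add_one_self[of "4 * \<theta>\<^sup>2"] by (intro ennreal_leI) linarith
  finally show ?thesis by (simp add: Z_def \<mu>_def \<theta>_def power_mult_distrib)
qed

text \<open>Markov's inequality for the exponential, whose mean factorises by independence. The sign
  of \<open>l\<close> is free, so both tails are covered.\<close>

lemma prob_sum_ge_Chernoff:
  fixes Z :: "'i \<Rightarrow> 'a \<Rightarrow> real"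
  assumes ind: "indep_vars (\<lambda>_. borel) Z I" and fin: "finite I"
    and mgf: "\<And>i. i \<in> I \<Longrightarrow> (\<integral>\<^sup>+w. ennreal (exp (l * Z i w)) \<partial>M) \<le> ennreal (exp v)"
  shows "prob {w \<in> space M. t \<le> l * (\<Sum>i\<in>I. Z i w)} \<le> exp (real (card I) * v - t)"
proof -
  have [measurable]: "Z i \<in> borel_measurable M" if "i \<in> I" for i
    using ind that by (auto simp: indep_vars_def)
  have "emeasure M {w \<in> space M. t \<le> l * (\<Sum>i\<in>I. Z i w)}
      = emeasure M ({w \<in> space M. 1 \<le> ennreal (exp (- t)) * ennreal (exp (l * (\<Sum>i\<in>I. Z i w)))} \<inter> space M)"
  proof (intro arg_cong[where f = "emeasure M"] Collect_cong)
    show "{w \<in> space M. t \<le> l * (\<Sum>i\<in>I. Z i w)}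
      = {w \<in> space M. 1 \<le> ennreal (exp (- t)) * ennreal (exp (l * (\<Sum>i\<in>I. Z i w)))} \<inter> space M"
      by (auto simp flip: ennreal_mult exp_add ennreal_1 simp del: ennreal_1)
  qed
  also have "\<dots> \<le> ennreal (exp (- t)) * (\<integral>\<^sup>+w. ennreal (exp (l * (\<Sum>i\<in>I. Z i w))) * indicator (space M) w \<partial>M)"
    by (rule order_trans[OF _ nn_integral_Markov_inequality]) auto
  also have "(\<integral>\<^sup>+w. ennreal (exp (l * (\<Sum>i\<in>I. Z i w))) * indicator (space M) w \<partial>M)
      = (\<integral>\<^sup>+w. (\<Prod>i\<in>I. ennreal (exp (l * Z i w))) \<partial>M)"
    by (intro nn_integral_cong)
      (simp add: sum_distrib_left exp_sum[OF fin] prod_ennreal)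
  also have "\<dots> = (\<Prod>i\<in>I. \<integral>\<^sup>+w. ennreal (exp (l * Z i w)) \<partial>M)"
    by (intro indep_vars_nn_integral fin indep_vars_compose2[OF ind]) auto
  also have "\<dots> \<le> (\<Prod>i\<in>I. ennreal (exp v))"
    by (intro prod_mono_ennreal mgf)
  also have "\<dots> = ennreal (exp (real (card I) * v))"
    by (simp add: ennreal_power exp_of_nat_mult)
  finally have "emeasure M {w \<in> space M. t \<le> l * (\<Sum>i\<in>I. Z i w)}
      \<le> ennreal (exp (- t)) * ennreal (exp (real (card I) * v))"
    by (simp add: mult_left_mono)
  also have "\<dots> = ennreal (exp (real (card I) * v - t))"
    by (simp add: exp_diff exp_minus field_simps flip: ennreal_mult)
  finally show ?thesis
    by (simp add: emeasure_eq_measure)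
qed

text \<open>Bernstein's inequality. The threshold is of order \<open>sqrt b\<close> in the Gaussian
  range b \<le> 1 and of order \<open>b\<close> beyond it; in both ranges the exponent is
  \<open>b\<close> per summand.\<close>

lemma prob_sum_centred_squares_ge:
  fixes Y :: "'i \<Rightarrow> 'a \<Rightarrow> real"
  assumes ind: "indep_vars (\<lambda>_. borel) Y I" and fin: "finite I" and K: "K > 0" and b: "b > 0"
    and int: "\<And>i q. i \<in> I \<Longrightarrow> q \<ge> 1 \<Longrightarrow> integrable M (\<lambda>w. Y i w ^ (2 * q))"
    and mom: "\<And>i q. i \<in> I \<Longrightarrow> q \<ge> 1 \<Longrightarrow>
      expectation (\<lambda>w. Y i w ^ (2 * q)) \<le> (2 * K\<^sup>2 * real q) ^ q"
  shows "prob {w \<in> space M. real (card I) * (8 * exp 1 * K\<^sup>2 * max (sqrt b) b)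
      \<le> \<bar>\<Sum>i\<in>I. (Y i w)\<^sup>2 - expectation (\<lambda>w. (Y i w)\<^sup>2)\<bar>} \<le> 2 * exp (- real (card I) * b)"
proof -
  define \<tau> where "\<tau> = 2 * exp 1 * K\<^sup>2"
  \<comment> \<open>The multiplier grows like \<open>sqrt b\<close>; the cap at 1 keeps
    \<open>\<tau> * l\<close> at most 1/2, as the bound on the exponential moment demands.\<close>
  define l where "l = min (sqrt b) 1 / (2 * \<tau>)"
  define Z where "Z = (\<lambda>i w. (Y i w)\<^sup>2 - expectation (\<lambda>w. (Y i w)\<^sup>2))"
  \<comment> \<open>Each summand costs a factor of at most \<open>exp b\<close> in the exponential
    moment, so a level of 2 b per summand leaves \<open>exp (- b)\<close>.\<close>
  define t where "t = 2 * real (card I) * b"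
  have \<tau>: "\<tau> > 0" using K by (simp add: \<tau>_def)
  have [measurable]: "Y i \<in> borel_measurable M" if "i \<in> I" for i
    using ind that by (auto simp: indep_vars_def)
  have indZ: "indep_vars (\<lambda>_. borel) Z I"
    unfolding Z_def by (rule indep_vars_compose2[OF ind]) measurable
  have [measurable]: "Z i \<in> borel_measurable M" if "i \<in> I" for i
    using indZ that by (auto simp: indep_vars_def)
  have l0: "l > 0" using b \<tau> by (simp add: l_def)
  have tl: "\<tau> * l = min (sqrt b) 1 / 2" using \<tau> by (simp add: l_def)
  \<comment> \<open>This identity lets one choice of \<open>l\<close> serve both ranges of
    \<open>b\<close>.\<close>
  have mm: "min (sqrt b) 1 * max (sqrt b) b = b"
  proof (cases "b \<le> 1")
    case True
    then have "sqrt b \<ge> b" using b real_le_rsqrt[of b b] by (simp add: power2_eq_square mult_left_le_one_le)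
    then show ?thesis using True b by (simp add: min_def max_def)
  next
    case False
    then have "sqrt b \<le> b" using b real_le_lsqrt[of b b] by (simp add: power2_eq_square)
    then show ?thesis using False b by (simp add: min_def max_def)
  qed
  have "(min (sqrt b) 1)\<^sup>2 \<le> (sqrt b)\<^sup>2" using b by (intro power_mono) auto
  then have v: "4 * (\<tau> * l)\<^sup>2 \<le> b" unfolding tl using b by (simp add: power_divide)
  have mgf: "(\<integral>\<^sup>+w. ennreal (exp (c * Z i w)) \<partial>M) \<le> ennreal (exp b)"
    if "i \<in> I" "\<bar>c\<bar> = l" for i c
  proof -
    have c: "\<tau> * \<bar>c\<bar> \<le> 1 / 2" using tl that by auto
    have "c\<^sup>2 = l\<^sup>2" using that(2) by (metis power2_abs)
    have "(\<integral>\<^sup>+w. ennreal (exp (c * Z i w)) \<partial>M) \<le> ennreal (exp (4 * (\<tau> * c)\<^sup>2))"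
      unfolding Z_def \<tau>_def using c that int mom
      by (intro nn_integral_exp_centred_square_le) (auto simp: \<tau>_def)
    also have "\<dots> \<le> ennreal (exp b)"
      using v \<open>c\<^sup>2 = l\<^sup>2\<close> by (intro ennreal_leI) (auto simp: power_mult_distrib)
    finally show ?thesis .
  qed
  have ch: "prob {w \<in> space M. t \<le> c * (\<Sum>i\<in>I. Z i w)} \<le> exp (- real (card I) * b)" if "\<bar>c\<bar> = l" for c
    using prob_sum_ge_Chernoff[OF indZ fin mgf[OF _ that], of t] by (simp add: t_def mult.commute)
  have lb: "l * (8 * exp 1 * K\<^sup>2 * max (sqrt b) b) = 2 * b"
  proof -
    have "l * (8 * exp 1 * K\<^sup>2 * max (sqrt b) b) = 4 * (\<tau> * l) * max (sqrt b) b"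
      by (simp add: \<tau>_def)
    also have "\<dots> = 2 * b" unfolding tl using mm by simp
    finally show ?thesis .
  qed
  have "prob {w \<in> space M. real (card I) * (8 * exp 1 * K\<^sup>2 * max (sqrt b) b) \<le> \<bar>\<Sum>i\<in>I. Z i w\<bar>}
      \<le> prob ({w \<in> space M. t \<le> l * (\<Sum>i\<in>I. Z i w)} \<union> {w \<in> space M. t \<le> - l * (\<Sum>i\<in>I. Z i w)})"
  proof (intro finite_measure_mono subsetI)
    fix w assume "w \<in> {w \<in> space M. real (card I) * (8 * exp 1 * K\<^sup>2 * max (sqrt b) b) \<le> \<bar>\<Sum>i\<in>I. Z i w\<bar>}"
    then have w: "w \<in> space M" and "real (card I) * (8 * exp 1 * K\<^sup>2 * max (sqrt b) b) \<le> \<bar>\<Sum>i\<in>I. Z i w\<bar>"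
      by auto
    then have "l * (real (card I) * (8 * exp 1 * K\<^sup>2 * max (sqrt b) b)) \<le> l * \<bar>\<Sum>i\<in>I. Z i w\<bar>"
      using l0 by (intro mult_left_mono) auto
    also have "l * (real (card I) * (8 * exp 1 * K\<^sup>2 * max (sqrt b) b)) = t"
      using lb by (simp add: t_def mult.left_commute)
    finally have "t \<le> l * \<bar>\<Sum>i\<in>I. Z i w\<bar>" .
    then show "w \<in> {w \<in> space M. t \<le> l * (\<Sum>i\<in>I. Z i w)} \<union> {w \<in> space M. t \<le> - l * (\<Sum>i\<in>I. Z i w)}"
      using w by (auto simp: abs_if split: if_splits)
  qed measurable
  also have "\<dots> \<le> prob {w \<in> space M. t \<le> l * (\<Sum>i\<in>I. Z i w)} + prob {w \<in> space M. t \<le> - l * (\<Sum>i\<in>I. Z i w)}"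
    by (intro measure_Un_le) measurable
  also have "\<dots> \<le> exp (- real (card I) * b) + exp (- real (card I) * b)"
    using l0 by (intro add_mono ch) auto
  finally show ?thesis by (simp add: Z_def)
qed

end

subsection \<open>Cuts of connected graphs\<close>

lemma simple_graph_finite: "simple_graph p E \<Longrightarrow> finite E"
  by (auto simp: simple_graph_def intro: finite_subset)

lemma connected_graph_card_pos:
  assumes "connected_graph p E" "p \<ge> 2"
  shows "card E \<ge> 1"
proof -
  have "(0, 1) \<in> (E \<union> E\<inverse>)\<^sup>*" using assms by (auto simp: connected_graph_def)
  then have "E \<noteq> {}" by auto
  then show ?thesis
    using simple_graph_finite[of p E] assms by (simp add: connected_graph_def Suc_le_eq card_gt_0_iff)
qed

text \<open>Follow a path from 0 to i. After its last edge of \<open>F\<close>, or from the start if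
  there is none, it stays in \<open>E - F\<close>, so \<open>r i\<close> can be 0 or an endpoint of
  an edge of \<open>F\<close>. The map \<open>r\<close> is chosen before \<open>x\<close>, so one
  net serves all vectors with the same cut.\<close>

lemma connected_graph_cut_retraction:
  fixes E :: "(nat \<times> nat) set"
  assumes G: "connected_graph p E" and p: "p > 0" and F: "F \<subseteq> E"
  shows "\<exists>r. card (r ` {..<p}) \<le> 2 * card F + 1 \<and>
    (\<forall>x :: nat \<Rightarrow> 'a. (\<forall>(u, v)\<in>E - F. x u = x v) \<longrightarrow> (\<forall>i<p. x i = x (r i)))"
proof -
  define T where "T = insert 0 (fst ` F \<union> snd ` F)"
  define R where "R = ((E - F) \<union> (E - F)\<inverse>)\<^sup>*"
  have finF: "finite F"
    using finite_subset[OF F] G simple_graph_finite[of p E] by (simp add: connected_graph_def)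
  \<comment> \<open>Induction along the path: an edge of \<open>F\<close> restarts the walk at its
    far endpoint, any other edge extends the current walk.\<close>
  have "\<exists>t\<in>T. (t, v) \<in> R" if "(0, v) \<in> (E \<union> E\<inverse>)\<^sup>*" for v
    using that
  proof induction
    case base
    then show ?case by (auto simp: T_def R_def)
  next
    case (step u v)
    then obtain t where t: "t \<in> T" "(t, u) \<in> R" by blast
    show ?case
    proof (cases "(u, v) \<in> F \<union> F\<inverse>")
      case True
      then have "v \<in> T" by (force simp: T_def)
      then show ?thesis by (auto simp: R_def)
    next
      case False
      then have "(u, v) \<in> (E - F) \<union> (E - F)\<inverse>" using step.hyps by auto
      then have "(t, v) \<in> R" using t(2) unfolding R_def by (rule rtrancl_into_rtrancl[rotated])
      then show ?thesis using t by blast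
    qed
  qed
  then have "\<forall>i\<in>{..<p}. \<exists>t. t \<in> T \<and> (t, i) \<in> R"
    using G p unfolding connected_graph_def by blast
  then obtain r where r: "\<And>i. i < p \<Longrightarrow> r i \<in> T \<and> (r i, i) \<in> R"
    by (metis lessThan_iff)
  have "card (fst ` F \<union> snd ` F) \<le> card (fst ` F) + card (snd ` F)"
    by (rule card_Un_le)
  also have "\<dots> \<le> card F + card F" by (intro add_mono card_image_le finF)
  finally have "card T \<le> 2 * card F + 1"
    using finF by (simp add: T_def card_insert_if)
  moreover have "card (r ` {..<p}) \<le> card T"
    using r finF by (intro card_mono) (simp add: T_def, blast)
  ultimately have "card (r ` {..<p}) \<le> 2 * card F + 1" by linarith
  moreover have "x i = x (r i)" if x: "\<forall>(u, v)\<in>E - F. x u = x v" and "i < p" for x :: "nat \<Rightarrow> 'a" and i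
  proof -
    have "x t = x v" if "(t, v) \<in> R" for t v
      using that unfolding R_def
    proof induction
      case (step u v)
      moreover have "x a = x b" if "(a, b) \<in> E - F" for a b using x that by blast
      ultimately show ?case by (metis UnE converseD)
    qed simp
    then show ?thesis using r that by metis
  qed
  ultimately show ?thesis by blast
qed

subsection \<open>Nets for spaces of blockwise constant vectors\<close>

definition quad_form :: "nat \<Rightarrow> (nat \<Rightarrow> nat \<Rightarrow> real) \<Rightarrow> (nat \<Rightarrow> real) \<Rightarrow> real" where
  "quad_form p S x = (\<Sum>j<p. \<Sum>k<p. S j k * x j * x k)"

definition fibre_const :: "nat \<Rightarrow> (nat \<Rightarrow> nat) \<Rightarrow> (nat \<Rightarrow> real) set" where
  "fibre_const p r = {x. \<exists>y. \<forall>i<p. x i = y (r i)}"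

definition fibre_card :: "nat \<Rightarrow> (nat \<Rightarrow> nat) \<Rightarrow> nat \<Rightarrow> real" where
  "fibre_card p r t = real (card {i \<in> {..<p}. r i = t})"

text \<open>
  With \<open>d\<close> fibres, the integers \<open>z\<close> are the coordinates in the orthonormal basis of normalised
  fibre indicators, in units of the mesh \<open>1 / (4 * sqrt d)\<close>; the condition on \<open>z\<close> cuts out
  the unit ball.
\<close>

definition fibre_net :: "nat \<Rightarrow> (nat \<Rightarrow> nat) \<Rightarrow> (nat \<Rightarrow> real) set" where
  "fibre_net p r = (\<lambda>z i. real_of_int (z (r i)) / (4 * sqrt (real (card (r ` {..<p})) * fibre_card p r (r i)))) `
     {z \<in> (r ` {..<p}) \<rightarrow>\<^sub>E UNIV. (\<Sum>t\<in>r ` {..<p}. (z t)\<^sup>2) \<le> int (16 * card (r ` {..<p}))}"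

text \<open>The full two-sided geometric series has total 3, which becomes the base in the count of
  lattice points.\<close>

lemma sum_half_pow_abs: "(\<Sum>z\<in>{- int N..int N}. (1 / 2 :: real) ^ nat \<bar>z\<bar>) = 3 - 2 * (1 / 2) ^ N"
proof (induction N)
  case (Suc N)
  have "{- int (Suc N)..int (Suc N)} = insert (int (Suc N)) (insert (- int (Suc N)) {- int N..int N})"
    by auto
  then show ?case using Suc by (simp add: nat_add_distrib)
qed simp

text \<open>Integers satisfy |a| \<le> a^2, so these points have l1 norm at most \<open>N\<close>.
  Each therefore has weight at least 1 under 2^N times 2^(- l1 norm), and the total weight over a
  box is a product of one-dimensional geometric sums.\<close>

lemma card_bounded_int_functions:
  fixes D :: "'a set" and N :: nat
  assumes D: "finite D"
  defines "Z \<equiv> {z \<in> D \<rightarrow>\<^sub>E (UNIV :: int set). (\<Sum>t\<in>D. (z t)\<^sup>2) \<le> int N}"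
  shows "finite Z" "real (card Z) \<le> 2 ^ N * 3 ^ card D"
proof -
  define B where "B = D \<rightarrow>\<^sub>E {- int N..int N}"
  have sq: "\<bar>a\<bar> \<le> a\<^sup>2" for a :: int
    using mult_left_mono[of 1 "\<bar>a\<bar>" "\<bar>a\<bar>"] by (cases "a = 0") (auto simp: power2_eq_square)
  have abs: "(\<Sum>t\<in>D. \<bar>z t\<bar>) \<le> int N" if "z \<in> Z" for z
    using that sum_mono[of D "\<lambda>t. \<bar>z t\<bar>" "\<lambda>t. (z t)\<^sup>2"] sq by (auto simp: Z_def intro: order_trans)
  have sub: "Z \<subseteq> B"
  proof
    fix z assume z: "z \<in> Z"
    have "\<bar>z t\<bar> \<le> int N" if "t \<in> D" for t
      using member_le_sum[OF that, of "\<lambda>t. \<bar>z t\<bar>"] D abs[OF z] by auto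
    then show "z \<in> B" using z by (force simp: B_def Z_def PiE_iff)
  qed
  have finB: "finite B" unfolding B_def using D by (intro finite_PiE) auto
  show "finite Z" using sub finB by (rule finite_subset)
  have "real (card Z) = (\<Sum>z\<in>Z. 1)" by simp
  also have "\<dots> \<le> (\<Sum>z\<in>Z. 2 ^ N * (\<Prod>t\<in>D. (1 / 2) ^ nat \<bar>z t\<bar>))"
  proof (rule sum_mono)
    fix z assume z: "z \<in> Z"
    have "int (\<Sum>t\<in>D. nat \<bar>z t\<bar>) \<le> int N" using abs[OF z] by simp
    then have "(\<Sum>t\<in>D. nat \<bar>z t\<bar>) \<le> N" by (simp only: of_nat_le_iff)
    then have "(1 / 2 :: real) ^ N \<le> (1 / 2) ^ (\<Sum>t\<in>D. nat \<bar>z t\<bar>)"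
      by (intro power_decreasing) auto
    then have "2 ^ N * (1 / 2 :: real) ^ N \<le> 2 ^ N * (1 / 2) ^ (\<Sum>t\<in>D. nat \<bar>z t\<bar>)"
      by (intro mult_left_mono) auto
    then show "1 \<le> 2 ^ N * (\<Prod>t\<in>D. (1 / 2 :: real) ^ nat \<bar>z t\<bar>)"
      by (simp add: power_sum power_one_over)
  qed
  also have "\<dots> \<le> (\<Sum>z\<in>B. 2 ^ N * (\<Prod>t\<in>D. (1 / 2) ^ nat \<bar>z t\<bar>))"
    using sub finB by (intro sum_mono2 mult_nonneg_nonneg prod_nonneg) auto
  also have "\<dots> = 2 ^ N * (\<Prod>t\<in>D. \<Sum>z\<in>{- int N..int N}. (1 / 2) ^ nat \<bar>z\<bar>)"
    unfolding B_def using D by (subst prod_sum_PiE) (auto simp: sum_distrib_left)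
  also have "\<dots> \<le> 2 ^ N * (\<Prod>t\<in>D. 3)"
    unfolding sum_half_pow_abs by (intro mult_left_mono prod_mono) (auto simp: power_le_one intro: order_trans[of _ "2 * 1"])
  finally show "real (card Z) \<le> 2 ^ N * 3 ^ card D" by simp
qed

text \<open>With d fibres the lattice points have squared norm at most N = 16 d, so the count 2^N *
  3^d is a d-th power. The size depends on the number of fibres and not on the ambient
  dimension.\<close>

lemma finite_fibre_net: "finite (fibre_net p r)"
  and card_fibre_net: "real (card (fibre_net p r)) \<le> (3 * 2 ^ 16) ^ card (r ` {..<p})"
proof -
  have fin: "finite (r ` {..<p})" by simp
  note Z = card_bounded_int_functions[OF fin, of "16 * card (r ` {..<p})"]
  show "finite (fibre_net p r)" unfolding fibre_net_def by (intro finite_imageI Z(1))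
  have "card (fibre_net p r) \<le> card {z \<in> (r ` {..<p}) \<rightarrow>\<^sub>E UNIV. (\<Sum>t\<in>r ` {..<p}. (z t)\<^sup>2) \<le> int (16 * card (r ` {..<p}))}"
    unfolding fibre_net_def by (rule card_image_le[OF Z(1)])
  also have "real \<dots> \<le> (3 * 2 ^ 16) ^ card (r ` {..<p})"
    using Z(2) by (simp only: power_mult_distrib power_mult[symmetric] mult.commute[of "3 ^ _"])
  finally show "real (card (fibre_net p r)) \<le> (3 * 2 ^ 16) ^ card (r ` {..<p})" by simp
qed

lemma sum_fibres:
  "(\<Sum>i<p. f (r i)) = (\<Sum>t\<in>r ` {..<p}. fibre_card p r t * f t)"
proof -
  have "(\<Sum>i<p. f (r i)) = (\<Sum>t\<in>r ` {..<p}. \<Sum>i\<in>{i \<in> {..<p}. r i = t}. f (r i))"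
    by (rule sum.image_gen) simp
  also have "\<dots> = (\<Sum>t\<in>r ` {..<p}. fibre_card p r t * f t)"
    by (rule sum.cong) (simp_all add: fibre_card_def)
  finally show ?thesis .
qed

lemma fibre_card_pos: "t \<in> r ` {..<p} \<Longrightarrow> fibre_card p r t > 0"
  by (auto simp: fibre_card_def card_gt_0_iff)

lemma fibre_net_subset: "fibre_net p r \<subseteq> fibre_const p r"
proof
  fix v assume "v \<in> fibre_net p r"
  then obtain z where "v = (\<lambda>i. real_of_int (z (r i)) / (4 * sqrt (real (card (r ` {..<p})) * fibre_card p r (r i))))"
    unfolding fibre_net_def by blast
  then show "v \<in> fibre_const p r"
    unfolding fibre_const_def
    by (intro CollectI exI[of _ "\<lambda>t. real_of_int (z t) / (4 * sqrt (real (card (r ` {..<p})) * fibre_card p r t))"]) simp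
qed

lemma fibre_net_norm:
  assumes "v \<in> fibre_net p r"
  shows "(\<Sum>i<p. (v i)\<^sup>2) \<le> 1"
proof -
  define D where "D = r ` {..<p}"
  define d where "d = real (card D)"
  obtain z where v: "v = (\<lambda>i. real_of_int (z (r i)) / (4 * sqrt (d * fibre_card p r (r i))))"
    and z: "(\<Sum>t\<in>D. (z t)\<^sup>2) \<le> int (16 * card D)"
    using assms by (auto simp: fibre_net_def D_def d_def)
  have "(\<Sum>i<p. (v i)\<^sup>2) = (\<Sum>t\<in>D. fibre_card p r t * (real_of_int (z t) / (4 * sqrt (d * fibre_card p r t)))\<^sup>2)"
    unfolding v D_def by (rule sum_fibres)
  also have "\<dots> = (\<Sum>t\<in>D. (real_of_int (z t))\<^sup>2 / (16 * d))"
  proof (intro sum.cong refl)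
    fix t assume "t \<in> D"
    then have "fibre_card p r t > 0" "d > 0"
      using fibre_card_pos[of t r p] by (auto simp: d_def D_def card_gt_0_iff)
    then show "fibre_card p r t * (real_of_int (z t) / (4 * sqrt (d * fibre_card p r t)))\<^sup>2 = (real_of_int (z t))\<^sup>2 / (16 * d)"
      by (simp add: power_divide power_mult_distrib field_simps)
  qed
  also have "\<dots> = real_of_int (\<Sum>t\<in>D. (z t)\<^sup>2) / (16 * d)"
    by (simp add: sum_divide_distrib)
  also have "\<dots> \<le> (16 * d) / (16 * d)"
  proof (intro divide_right_mono)
    have "real_of_int (\<Sum>t\<in>D. (z t)\<^sup>2) \<le> real_of_int (int (16 * card D))" using z by (simp only: of_int_le_iff)
    then show "real_of_int (\<Sum>t\<in>D. (z t)\<^sup>2) \<le> 16 * d" by (simp add: d_def)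
  qed (simp add: d_def)
  also have "\<dots> \<le> 1" by simp
  finally show ?thesis .
qed

text \<open>Rounding moves each of the d coordinates by at most one mesh 1 / (4 sqrt d), so the
  squared error is at most d / (16 d).\<close>

lemma fibre_net_approx:
  assumes x: "x \<in> fibre_const p r" and n: "(\<Sum>i<p. (x i)\<^sup>2) \<le> 1"
  obtains v where "v \<in> fibre_net p r" "(\<Sum>i<p. (x i - v i)\<^sup>2) \<le> 1 / 16"
proof -
  define D where "D = r ` {..<p}"
  define d where "d = real (card D)"
  obtain y where y: "\<And>i. i < p \<Longrightarrow> x i = y (r i)" using x by (auto simp: fibre_const_def)
  define a where "a = (\<lambda>t. 4 * sqrt (d * fibre_card p r t) * y t)"
  \<comment> \<open>Rounding towards zero rather than to the nearest integer does not increase any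
    coordinate in absolute value, so the result still satisfies the ball constraint of the
    net.\<close>
  define z where "z = restrict (\<lambda>t. if a t \<ge> 0 then \<lfloor>a t\<rfloor> else \<lceil>a t\<rceil>) D"
  define v where "v = (\<lambda>i. real_of_int (z (r i)) / (4 * sqrt (d * fibre_card p r (r i))))"
  have m: "fibre_card p r t > 0" "d > 0" if "t \<in> D" for t
    using that fibre_card_pos[of t r p] by (auto simp: d_def D_def card_gt_0_iff)
  have z1: "\<bar>real_of_int (z t)\<bar> \<le> \<bar>a t\<bar>" if "t \<in> D" for t
    using that by (auto simp: z_def; linarith)
  have z2: "\<bar>a t - real_of_int (z t)\<bar> \<le> 1" if "t \<in> D" for t
    using that by (auto simp: z_def; linarith)
  have "(\<Sum>t\<in>D. fibre_card p r t * (y t)\<^sup>2) = (\<Sum>i<p. (x i)\<^sup>2)"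
    unfolding D_def using sum_fibres[of "\<lambda>t. (y t)\<^sup>2" r p] y by simp
  then have yn: "(\<Sum>t\<in>D. fibre_card p r t * (y t)\<^sup>2) \<le> 1" using n by simp
  have "(\<Sum>t\<in>D. (real_of_int (z t))\<^sup>2) \<le> (\<Sum>t\<in>D. (a t)\<^sup>2)"
    using z1 by (intro sum_mono) (auto simp: abs_le_square_iff)
  also have "\<dots> = (\<Sum>t\<in>D. 16 * d * (fibre_card p r t * (y t)\<^sup>2))"
    using m by (intro sum.cong) (auto simp: a_def power_mult_distrib less_imp_le)
  also have "\<dots> \<le> 16 * d" using yn by (simp add: d_def mult_left_le flip: sum_distrib_left)
  finally have "real_of_int (\<Sum>t\<in>D. (z t)\<^sup>2) \<le> real_of_int (int (16 * card D))" by (simp add: d_def)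
  then have "(\<Sum>t\<in>D. (z t)\<^sup>2) \<le> int (16 * card D)" by (simp only: of_int_le_iff)
  then have "v \<in> fibre_net p r"
    unfolding fibre_net_def v_def D_def[symmetric] d_def by (intro imageI) (auto simp: z_def)
  moreover have "(\<Sum>i<p. (x i - v i)\<^sup>2) \<le> 1 / 16"
  proof -
    have "(\<Sum>i<p. (x i - v i)\<^sup>2) = (\<Sum>i<p. (y (r i) - real_of_int (z (r i)) / (4 * sqrt (d * fibre_card p r (r i))))\<^sup>2)"
      using y by (simp add: v_def)
    also have "\<dots> = (\<Sum>t\<in>D. fibre_card p r t * (y t - real_of_int (z t) / (4 * sqrt (d * fibre_card p r t)))\<^sup>2)"
      unfolding D_def by (rule sum_fibres)
    also have "\<dots> \<le> (\<Sum>t\<in>D. 1 / (16 * d))"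
    proof (rule sum_mono)
      fix t assume t: "t \<in> D"
      have "y t = a t / (4 * sqrt (d * fibre_card p r t))" using m[OF t] by (simp add: a_def)
      then have "y t - real_of_int (z t) / (4 * sqrt (d * fibre_card p r t)) = (a t - real_of_int (z t)) / (4 * sqrt (d * fibre_card p r t))"
        by (simp add: diff_divide_distrib)
      then have "fibre_card p r t * (y t - real_of_int (z t) / (4 * sqrt (d * fibre_card p r t)))\<^sup>2 = (a t - real_of_int (z t))\<^sup>2 / (16 * d)"
        using m[OF t] by (simp add: power_divide power_mult_distrib)
      also have "\<dots> \<le> 1 / (16 * d)"
        using z2[OF t] m[OF t] by (intro divide_right_mono) (auto simp: abs_square_le_1)
      finally show "fibre_card p r t * (y t - real_of_int (z t) / (4 * sqrt (d * fibre_card p r t)))\<^sup>2 \<le> 1 / (16 * d)" .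
    qed
    also have "\<dots> \<le> 1 / 16" by (simp add: d_def)
    finally show ?thesis .
  qed
  ultimately show ?thesis by (rule that)
qed

section \<open>Quadratic forms on the unit ball and on its net\<close>

lemma quad_form_scale: "quad_form p S (\<lambda>i. c * x i) = c\<^sup>2 * quad_form p S x"
  unfolding quad_form_def by (simp add: sum_distrib_left power2_eq_square mult_ac)

text \<open>
  Polarisation, balanced for \<open>v\<close> in the unit ball and \<open>g\<close> of norm at most \<open>1 / 4\<close>: the squared norms of the
  two mixed vectors then add up to at most 1.
\<close>

lemma quad_form_perturb:
  "quad_form p S (\<lambda>i. v i + g i) = quad_form p S v + quad_form p S g
    + (quad_form p S (\<lambda>i. 2 * g i + v i / 2) - quad_form p S (\<lambda>i. 2 * g i - v i / 2)) / 2"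
proof -
  have "quad_form p S (\<lambda>i. v i + g i) = (\<Sum>j<p. \<Sum>k<p. S j k * v j * v k + S j k * g j * g k
    + (S j k * (2 * g j + v j / 2) * (2 * g k + v k / 2)
      - S j k * (2 * g j - v j / 2) * (2 * g k - v k / 2)) / 2)"
    unfolding quad_form_def by (intro sum.cong refl) (simp add: field_simps)
  also have "\<dots> = quad_form p S v + quad_form p S g
    + (quad_form p S (\<lambda>i. 2 * g i + v i / 2) - quad_form p S (\<lambda>i. 2 * g i - v i / 2)) / 2"
    unfolding quad_form_def sum.distrib sum_divide_distrib[symmetric] sum_subtractf ..
  finally show ?thesis .
qed

text \<open>A crude bound, since each product of two coordinates is at most the squared norm. It
  makes the supremum over the ball finite and settles vectors of norm zero.\<close>

lemma quad_form_abs_le: "\<bar>quad_form p S x\<bar> \<le> (\<Sum>j<p. \<Sum>k<p. \<bar>S j k\<bar>) * (\<Sum>i<p. (x i)\<^sup>2)"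
proof -
  have "\<bar>S j k * x j * x k\<bar> \<le> \<bar>S j k\<bar> * (\<Sum>i<p. (x i)\<^sup>2)" if "j < p" "k < p" for j k
  proof -
    have s: "(x i)\<^sup>2 \<le> (\<Sum>i<p. (x i)\<^sup>2)" if "i < p" for i
      using that by (intro member_le_sum) auto
    have "2 * (\<bar>x j\<bar> * \<bar>x k\<bar>) \<le> (x j)\<^sup>2 + (x k)\<^sup>2"
      using sum_squares_bound[of "\<bar>x j\<bar>" "\<bar>x k\<bar>"] by (simp add: mult.assoc)
    then have "\<bar>x j\<bar> * \<bar>x k\<bar> \<le> (\<Sum>i<p. (x i)\<^sup>2)" using s[OF that(1)] s[OF that(2)] by linarith
    then show ?thesis by (simp add: abs_mult mult.assoc mult_left_mono)
  qed
  then have "\<bar>quad_form p S x\<bar> \<le> (\<Sum>j<p. \<Sum>k<p. \<bar>S j k\<bar> * (\<Sum>i<p. (x i)\<^sup>2))"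
    unfolding quad_form_def by (intro order_trans[OF sum_abs] sum_mono) auto
  then show ?thesis by (simp add: sum_distrib_right)
qed

text \<open>The supremum \<open>B\<close> over the unit ball bounds itself: for f = v + g with v in
  the net, v contributes \<eta>, g contributes B / 16 and the mixed terms B / 2. Hence B \<le>
  \<eta> + 9 B / 16, that is, B \<le> 16 \<eta> / 7.\<close>

lemma quad_form_bound_from_net:
  assumes net: "\<And>v. v \<in> fibre_net p r \<Longrightarrow> \<bar>quad_form p S v\<bar> \<le> \<eta>"
    and x: "x \<in> fibre_const p r"
  shows "\<bar>quad_form p S x\<bar> \<le> 3 * \<eta> * (\<Sum>i<p. (x i)\<^sup>2)"
proof -
  define W where "W = {x \<in> fibre_const p r. (\<Sum>i<p. (x i)\<^sup>2) \<le> 1}"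
  define B where "B = (SUP x\<in>W. \<bar>quad_form p S x\<bar>)"
  have lin: "(\<lambda>i. c * f i + e * g i) \<in> fibre_const p r" if fg: "f \<in> fibre_const p r" "g \<in> fibre_const p r" for f g c e
  proof -
    obtain f' g' where "\<forall>i<p. f i = f' (r i)" "\<forall>i<p. g i = g' (r i)"
      using fg by (auto simp: fibre_const_def)
    then show ?thesis by (auto simp: fibre_const_def intro!: exI[of _ "\<lambda>t. c * f' t + e * g' t"])
  qed
  have bdd: "bdd_above ((\<lambda>x. \<bar>quad_form p S x\<bar>) ` W)"
  proof (rule bdd_aboveI2)
    fix x assume "x \<in> W"
    then have "(\<Sum>j<p. \<Sum>k<p. \<bar>S j k\<bar>) * (\<Sum>i<p. (x i)\<^sup>2) \<le> (\<Sum>j<p. \<Sum>k<p. \<bar>S j k\<bar>) * 1"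
      by (intro mult_left_mono) (auto simp: W_def intro!: sum_nonneg)
    then show "\<bar>quad_form p S x\<bar> \<le> (\<Sum>j<p. \<Sum>k<p. \<bar>S j k\<bar>)"
      using quad_form_abs_le[of p S x] by simp
  qed
  have B1: "\<bar>quad_form p S f\<bar> \<le> B" if "f \<in> W" for f
    unfolding B_def using bdd that by (rule cSUP_upper2) auto
  have zero: "(\<lambda>_. 0) \<in> W" by (auto simp: W_def fibre_const_def)
  have B: "\<bar>quad_form p S f\<bar> \<le> B * (\<Sum>i<p. (f i)\<^sup>2)" if f: "f \<in> fibre_const p r" for f
  proof (cases "(\<Sum>i<p. (f i)\<^sup>2) = 0")
    case True
    then show ?thesis using quad_form_abs_le[of p S f] by simp
  next
    case False
    define N where "N = (\<Sum>i<p. (f i)\<^sup>2)"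
    have N: "N > 0" using False by (simp add: N_def less_le sum_nonneg)
    have "(\<Sum>i<p. (1 / sqrt N * f i)\<^sup>2) = (\<Sum>i<p. (f i)\<^sup>2 / N)"
      using N by (simp add: power_mult_distrib power_divide)
    also have "\<dots> = N / N" unfolding N_def by (rule sum_divide_distrib[symmetric])
    finally have "(\<Sum>i<p. (1 / sqrt N * f i)\<^sup>2) = 1" using N by simp
    then have "(\<lambda>i. 1 / sqrt N * f i) \<in> W"
      using lin[OF f f, of "1 / sqrt N" 0] by (simp add: W_def)
    from B1[OF this] have "\<bar>quad_form p S f\<bar> / N \<le> B"
      unfolding quad_form_scale using N by (simp add: power_divide abs_mult)
    then show ?thesis using N by (simp add: field_simps N_def)
  qed
  have "B \<le> \<eta> + 9 * B / 16"
    unfolding B_def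
  proof (rule cSUP_least)
    show "W \<noteq> {}" using zero by auto
    fix f assume f: "f \<in> W"
    then have fc: "f \<in> fibre_const p r" "(\<Sum>i<p. (f i)\<^sup>2) \<le> 1" by (auto simp: W_def)
    obtain v where v: "v \<in> fibre_net p r" "(\<Sum>i<p. (f i - v i)\<^sup>2) \<le> 1 / 16"
      using fibre_net_approx[OF fc] .
    define g where "g = (\<lambda>i. f i - v i)"
    have vc: "v \<in> fibre_const p r" using v fibre_net_subset by blast
    have gc: "g \<in> fibre_const p r" using lin[OF fc(1) vc, of 1 "-1"] by (simp add: g_def)
    have ng: "(\<Sum>i<p. (g i)\<^sup>2) \<le> 1 / 16" using v by (simp add: g_def)
    have nv: "(\<Sum>i<p. (v i)\<^sup>2) \<le> 1" using fibre_net_norm[OF v(1)] .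
    have c1: "(\<lambda>i. 2 * g i + v i / 2) \<in> fibre_const p r" using lin[OF gc vc, of 2 "1/2"] by simp
    have c2: "(\<lambda>i. 2 * g i - v i / 2) \<in> fibre_const p r" using lin[OF gc vc, of 2 "-1/2"] by simp
    have B0: "B \<ge> 0" using B1[OF zero] by linarith
    have "(\<Sum>i<p. (2 * g i + v i / 2)\<^sup>2) + (\<Sum>i<p. (2 * g i - v i / 2)\<^sup>2)
        = (\<Sum>i<p. 8 * (g i)\<^sup>2 + (v i)\<^sup>2 / 2)"
      unfolding sum.distrib[symmetric]
      by (intro sum.cong refl) (simp add: power2_eq_square field_simps)
    also have "\<dots> = 8 * (\<Sum>i<p. (g i)\<^sup>2) + (\<Sum>i<p. (v i)\<^sup>2) / 2"
      unfolding sum.distrib sum_distrib_left sum_divide_distrib ..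
    also have "\<dots> \<le> 1" using ng nv by simp
    finally have XY: "B * (\<Sum>i<p. (2 * g i + v i / 2)\<^sup>2) + B * (\<Sum>i<p. (2 * g i - v i / 2)\<^sup>2) \<le> B"
      using B0 by (simp add: mult_left_le flip: distrib_left)
    have G: "B * (\<Sum>i<p. (g i)\<^sup>2) \<le> B / 16" using mult_left_mono[OF ng B0] by simp
    have fq: "quad_form p S f = quad_form p S v + quad_form p S g
      + (quad_form p S (\<lambda>i. 2 * g i + v i / 2) - quad_form p S (\<lambda>i. 2 * g i - v i / 2)) / 2"
      using quad_form_perturb[of p S v g] by (simp add: g_def)
    have arith: "\<bar>q\<bar> \<le> \<eta> + 9 * B / 16"
      if "q = a + b + (c - d) / 2" "\<bar>a\<bar> \<le> \<eta>" "\<bar>b\<bar> \<le> G" "\<bar>c\<bar> \<le> X" "\<bar>d\<bar> \<le> Y" "X + Y \<le> B" "G \<le> B / 16"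
      for q a b c d G X Y :: real
      using that unfolding abs_le_iff by argo
    show "\<bar>quad_form p S f\<bar> \<le> \<eta> + 9 * (SUP x\<in>W. \<bar>quad_form p S x\<bar>) / 16"
      unfolding B_def[symmetric] by (rule arith[OF fq net[OF v(1)] B[OF gc] B[OF c1] B[OF c2] XY G])
  qed
  \<comment> \<open>Nonnegativity of \<open>B\<close> forces \<eta> \<ge> 0, so that 16 / 7 can be
    rounded up to 3.\<close>
  moreover have "0 \<le> B" using B1[OF zero] by linarith
  ultimately have "B \<le> 3 * \<eta>" by linarith
  then show ?thesis
    using B[OF x] mult_right_mono[of B "3 * \<eta>" "\<Sum>i<p. (x i)\<^sup>2"] by (auto simp: sum_nonneg intro: order_trans)
qed

subsection \<open>Rayleigh quotients and the extreme eigenvalues\<close>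

text \<open>This is the sphere of R^p inside the functions on all naturals. With the coordinates
  from \<open>p\<close> on pinned to 0, it is a closed subset of a product of intervals, which is
  compact by Tychonoff's theorem.\<close>

lemma compact_unit_sphere_fun: "compact {x :: nat \<Rightarrow> real. (\<forall>i\<ge>p. x i = 0) \<and> (\<Sum>i<p. (x i)\<^sup>2) = 1}"
proof -
  let ?U = "{x :: nat \<Rightarrow> real. (\<forall>i\<ge>p. x i = 0) \<and> (\<Sum>i<p. (x i)\<^sup>2) = 1}"
  have "compactin (product_topology (\<lambda>i::nat. euclidean) UNIV) (PiE UNIV (\<lambda>_. {-1..1::real}))"
    by (simp add: compactin_PiE)
  then have cpt: "compact (PiE UNIV (\<lambda>_::nat. {-1..1::real}))"
    by (simp add: euclidean_product_topology)
  have cl: "closed ?U"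
    by (intro closed_Collect_conj closed_Collect_all closed_Collect_imp closed_Collect_eq open_Collect_const
        continuous_intros continuous_on_product_coordinates)
  have sub: "?U \<subseteq> PiE UNIV (\<lambda>_. {-1..1})"
  proof (clarsimp simp: PiE_iff)
    fix x :: "nat \<Rightarrow> real" and i assume x: "\<forall>i\<ge>p. x i = 0" "(\<Sum>i<p. (x i)\<^sup>2) = 1"
    have "\<bar>x i\<bar> \<le> 1"
    proof (cases "i < p")
      case True
      then have "(x i)\<^sup>2 \<le> 1" using member_le_sum[of i "{..<p}" "\<lambda>i. (x i)\<^sup>2"] x by simp
      then show ?thesis by (simp add: abs_square_le_1)
    qed (use x in auto)
    then show "- 1 \<le> x i \<and> x i \<le> 1" by auto
  qed
  show ?thesis using compact_Int_closed[OF cpt cl] unfolding Int_absorb1[OF sub] .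
qed

lemma quad_form_cong:
  "(\<And>i. i < p \<Longrightarrow> x i = y i) \<Longrightarrow> quad_form p S x = quad_form p S y"
  unfolding quad_form_def by (auto intro!: sum.cong)

text \<open>Compactness gives a maximiser \<open>u\<close> of the form on the sphere. Its first
  variation in every coordinate direction vanishes, which is the eigenvector equation with the
  maximum as eigenvalue.\<close>

lemma quad_form_max_eigenvector:
  assumes sym: "\<And>j k. j < p \<Longrightarrow> k < p \<Longrightarrow> S j k = S k j" and p: "p \<ge> 1"
  obtains l u where "\<exists>i<p. u i \<noteq> (0::real)" "\<And>j. j < p \<Longrightarrow> (\<Sum>k<p. S j k * u k) = l * u j"
    "\<And>x. quad_form p S x \<le> l * (\<Sum>i<p. (x i)\<^sup>2)"
proof -
  define U where "U = {x :: nat \<Rightarrow> real. (\<forall>i\<ge>p. x i = 0) \<and> (\<Sum>i<p. (x i)\<^sup>2) = 1}"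
  have "(\<lambda>i. if i = 0 then 1 else 0) \<in> U"
    using p by (auto simp: U_def if_distrib[of "\<lambda>x. x\<^sup>2"] cong: if_cong)
  then have ne: "U \<noteq> {}" by blast
  have "continuous_on U (quad_form p S)"
    unfolding quad_form_def
    by (intro continuous_intros continuous_on_subset[OF continuous_on_product_coordinates]) auto
  with compact_unit_sphere_fun[of p] ne obtain u where u: "u \<in> U"
    and umax: "\<And>x. x \<in> U \<Longrightarrow> quad_form p S x \<le> quad_form p S u"
    unfolding U_def[symmetric] using continuous_attains_sup by metis
  define l where "l = quad_form p S u"
  have bound: "quad_form p S x \<le> l * (\<Sum>i<p. (x i)\<^sup>2)" for x
  proof (cases "(\<Sum>i<p. (x i)\<^sup>2) = 0")
    case True
    then show ?thesis using quad_form_abs_le[of p S x] by simp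
  next
    case False
    define N where "N = (\<Sum>i<p. (x i)\<^sup>2)"
    have N: "N > 0" using False by (simp add: N_def less_le sum_nonneg)
    define y where "y = (\<lambda>i. if i < p then 1 / sqrt N * x i else 0)"
    have "(\<Sum>i<p. (y i)\<^sup>2) = (\<Sum>i<p. (x i)\<^sup>2 / N)"
      using N by (simp add: y_def power_mult_distrib power_divide)
    also have "\<dots> = N / N" unfolding N_def by (rule sum_divide_distrib[symmetric])
    finally have "(\<Sum>i<p. (y i)\<^sup>2) = 1" using N by simp
    then have "y \<in> U" by (simp add: U_def y_def)
    then have "quad_form p S y \<le> l" unfolding l_def by (rule umax)
    also have "quad_form p S y = quad_form p S (\<lambda>i. 1 / sqrt N * x i)"
      by (rule quad_form_cong) (simp add: y_def)
    also have "\<dots> = quad_form p S x / N" using N by (simp only: quad_form_scale) (simp add: power_divide)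
    finally show ?thesis using N by (simp add: field_simps N_def)
  qed
  have u1: "(\<Sum>i<p. (u i)\<^sup>2) = 1" using u by (simp add: U_def)
  have "(\<Sum>k<p. S j k * u k) = l * u j" if j: "j < p" for j
  proof -
    \<comment> \<open>Moving \<open>u\<close> by t in direction j changes l times the squared norm
      minus the form from 0 to 2 t b + t^2 c, and this difference is never negative.\<close>
    define b where "b = l * u j - (\<Sum>k<p. S j k * u k)"
    define c where "c = l - S j j"
    have "0 \<le> 2 * t * b + t\<^sup>2 * c" for t
    proof -
      define e where "e = (\<lambda>i. if i = j then t else 0 :: real)"
      have "(\<Sum>i<p. (u i + e i)\<^sup>2) = (\<Sum>i<p. (u i)\<^sup>2) + (\<Sum>i<p. 2 * u i * e i + (e i)\<^sup>2)"
        unfolding sum.distrib[symmetric] by (intro sum.cong refl) (simp add: power2_sum)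
      also have "(\<Sum>i<p. 2 * u i * e i + (e i)\<^sup>2) = (\<Sum>i<p. if i = j then 2 * u j * t + t\<^sup>2 else 0)"
        by (rule sum.cong) (auto simp: e_def)
      finally have n1: "(\<Sum>i<p. (u i + e i)\<^sup>2) = 1 + 2 * u j * t + t\<^sup>2" using j u1 by simp
      have row: "(\<Sum>k<p. S i k * f k * e i) = (if i = j then t * (\<Sum>k<p. S j k * f k) else 0)" for i f
        by (simp add: e_def sum_distrib_left mult_ac)
      have "quad_form p S (\<lambda>i. u i + e i)
        = (\<Sum>i<p. \<Sum>k<p. S i k * u i * u k) + (\<Sum>i<p. \<Sum>k<p. S i k * u k * e i)
          + (\<Sum>i<p. \<Sum>k<p. S i k * u i * e k) + (\<Sum>i<p. \<Sum>k<p. S i k * e k * e i)"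
        unfolding quad_form_def sum.distrib[symmetric] by (intro sum.cong refl) (simp add: algebra_simps)
      \<comment> \<open>Symmetry of \<open>S\<close> identifies the two cross terms.\<close>
      also have "(\<Sum>i<p. \<Sum>k<p. S i k * u i * e k) = (\<Sum>k<p. \<Sum>i<p. S k i * u i * e k)"
        by (subst sum.swap, intro sum.cong refl) (simp add: sym)
      finally have "quad_form p S (\<lambda>i. u i + e i)
        = l + 2 * t * (\<Sum>k<p. S j k * u k) + t * (\<Sum>k<p. S j k * e k)"
        using j by (simp add: row l_def quad_form_def)
      also have "(\<Sum>k<p. S j k * e k) = (\<Sum>k<p. if k = j then S j j * t else 0)"
        by (rule sum.cong) (auto simp: e_def)
      finally have "quad_form p S (\<lambda>i. u i + e i) = l + 2 * t * (\<Sum>k<p. S j k * u k) + t * (S j j * t)"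
        using j by simp
      then have "l + 2 * t * (\<Sum>k<p. S j k * u k) + t * (S j j * t) \<le> l * (1 + 2 * u j * t + t\<^sup>2)"
        using bound[of "\<lambda>i. u i + e i"] unfolding n1 by linarith
      then show ?thesis
        by (simp add: b_def c_def algebra_simps power2_eq_square)
    qed
    note pos = this
    have "b = 0"
    proof (rule ccontr)
      assume b: "b \<noteq> 0"
      \<comment> \<open>\<open>d\<close> dominates \<open>c\<close> and is positive whatever the
        sign of \<open>c\<close>; then t = - b / d makes the quadratic at most - b^2 / d.\<close>
      define d where "d = 1 + \<bar>c\<bar>"
      define t where "t = - b / d"
      have d: "d > 0" by (simp add: d_def add_pos_nonneg)
      have "2 * t * b + t\<^sup>2 * c \<le> 2 * t * b + t\<^sup>2 * d"
        unfolding d_def by (intro add_left_mono mult_left_mono) auto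
      also have "\<dots> = - (b\<^sup>2 / d)"
        using d by (simp add: t_def power2_eq_square field_simps)
      also have "\<dots> < 0" using b d by simp
      finally show False using pos[of t] by simp
    qed
    then show ?thesis by (simp add: b_def)
  qed
  moreover have "\<exists>i<p. u i \<noteq> 0"
  proof (rule ccontr)
    assume "\<not> (\<exists>i<p. u i \<noteq> 0)"
    then have "(\<Sum>i<p. (u i)\<^sup>2) = 0" by simp
    then show False using u1 by simp
  qed
  ultimately show ?thesis using that bound by blast
qed

lemma eigenvalueI_sum:
  fixes A :: "real mat"
  assumes A: "A \<in> carrier_mat p p" and u: "\<exists>i<p. u i \<noteq> 0"
    and e: "\<And>j. j < p \<Longrightarrow> (\<Sum>k<p. A $$ (j, k) * u k) = l * u j"
  shows "l \<in> spectrum A"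
proof -
  have "A *\<^sub>v vec p u = l \<cdot>\<^sub>v vec p u"
    using A e by (intro eq_vecI) (auto simp: scalar_prod_def lessThan_atLeast0 intro!: sum.cong)
  moreover have "vec p u \<noteq> 0\<^sub>v p" using u by (metis index_vec index_zero_vec(1))
  ultimately show ?thesis
    using A by (auto simp: spectrum_def eigenvalue_def eigenvector_def intro!: exI[of _ "vec p u"])
qed

text \<open>The maximum of the Rayleigh quotient is itself an eigenvalue, hence at most the largest
  element of the finite spectrum.\<close>

lemma quad_form_le_sigma_max:
  assumes A: "A \<in> carrier_mat p p" and p: "p \<ge> 1"
    and sym: "\<And>j k. j < p \<Longrightarrow> k < p \<Longrightarrow> A $$ (j, k) = A $$ (k, j)"
  shows "quad_form p (\<lambda>j k. A $$ (j, k)) x \<le> sigma_max A * (\<Sum>i<p. (x i)\<^sup>2)"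
proof -
  obtain l u where u: "\<exists>i<p. u i \<noteq> 0" and e: "\<And>j. j < p \<Longrightarrow> (\<Sum>k<p. A $$ (j, k) * u k) = l * u j"
    and b: "\<And>x. quad_form p (\<lambda>j k. A $$ (j, k)) x \<le> l * (\<Sum>i<p. (x i)\<^sup>2)"
    by (rule quad_form_max_eigenvector[of p "\<lambda>j k. A $$ (j, k)"]) (use sym p in auto)
  have "l \<in> spectrum A" using A u e by (rule eigenvalueI_sum)
  then have "l \<le> sigma_max A" using card_finite_spectrum(1)[OF A] by (simp add: sigma_max_def)
  then show ?thesis using b[of x] mult_right_mono[of l "sigma_max A" "\<Sum>i<p. (x i)\<^sup>2"]
    by (auto simp: sum_nonneg intro: order_trans)
qed

text \<open>The maximum principle is applied to the negated matrix; an eigenvector for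
  \<open>l\<close> there is one for \<open>- l\<close> here.\<close>

lemma sigma_min_le_quad_form:
  assumes A: "A \<in> carrier_mat p p" and p: "p \<ge> 1"
    and sym: "\<And>j k. j < p \<Longrightarrow> k < p \<Longrightarrow> A $$ (j, k) = A $$ (k, j)"
  shows "sigma_min A * (\<Sum>i<p. (x i)\<^sup>2) \<le> quad_form p (\<lambda>j k. A $$ (j, k)) x"
proof -
  obtain l u where u: "\<exists>i<p. u i \<noteq> 0" and e: "\<And>j. j < p \<Longrightarrow> (\<Sum>k<p. - A $$ (j, k) * u k) = l * u j"
    and b: "\<And>x. quad_form p (\<lambda>j k. - A $$ (j, k)) x \<le> l * (\<Sum>i<p. (x i)\<^sup>2)"
    by (rule quad_form_max_eigenvector[of p "\<lambda>j k. - A $$ (j, k)"]) (use sym p in auto)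
  have "- l \<in> spectrum A" using A u
  proof (rule eigenvalueI_sum)
    show "(\<Sum>k<p. A $$ (j, k) * u k) = - l * u j" if "j < p" for j
      using e[OF that] by (simp add: sum_negf)
  qed
  then have "sigma_min A \<le> - l" using card_finite_spectrum(1)[OF A] by (simp add: sigma_min_def)
  then have "sigma_min A * (\<Sum>i<p. (x i)\<^sup>2) \<le> - l * (\<Sum>i<p. (x i)\<^sup>2)"
    by (intro mult_right_mono) (auto simp: sum_nonneg)
  moreover have "quad_form p (\<lambda>j k. - A $$ (j, k)) x = - quad_form p (\<lambda>j k. A $$ (j, k)) x"
    by (simp add: quad_form_def sum_negf)
  ultimately show ?thesis using b[of x] by simp
qed

subsection \<open>Measurability of the cut-restricted isometry property\<close>

lemma crip_function_rho_log:
  assumes C: "C \<ge> 0"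
  shows "crip_function (rho_log C n E)"
proof -
  define m where "m = real (card E)"
  have m: "m \<ge> 0" by (simp add: m_def)
  define \<rho>1 where "\<rho>1 = (\<lambda>s. C / real n * (ln (1 + m / s) - m / (s + m)))"
  define \<rho>2 where "\<rho>2 = (\<lambda>s. C / real n * (- (m\<^sup>2) / (s * (s + m)\<^sup>2)))"
  have "rho_log C n E s \<ge> 0" if "s \<ge> 0" for s
    using that C by (auto simp: rho_log_def intro!: divide_nonneg_nonneg mult_nonneg_nonneg ln_ge_zero)
  moreover have "(rho_log C n E has_real_derivative \<rho>1 s) (at s) \<and> (\<rho>1 has_real_derivative \<rho>2 s) (at s)
      \<and> \<rho>1 s \<ge> 0 \<and> \<rho>2 s \<le> 0" if s: "s > 0" for s
  proof (intro conjI)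
    have pos: "1 + m / s > 0" "s + m > 0" using s m by (auto intro: add_pos_nonneg)
    have ms: "m / s / (1 + m / s) = m / (s + m)" using s pos by (simp add: field_simps)
    have "((\<lambda>s. C / real n * (s * ln (1 + m / s))) has_real_derivative
        C / real n * (1 * ln (1 + m / s) + (inverse (1 + m / s) * (- m / s\<^sup>2)) * s)) (at s)"
      using s pos by (auto intro!: derivative_eq_intros simp: power2_eq_square divide_inverse)
    also have "(inverse (1 + m / s) * (- m / s\<^sup>2)) * s = - (m / (s + m))"
      using s unfolding ms[symmetric] by (simp add: power2_eq_square divide_inverse mult_ac)
    finally show "(rho_log C n E has_real_derivative \<rho>1 s) (at s)"
      by (simp add: rho_log_def[abs_def] \<rho>1_def m_def mult.assoc)
    have "((\<lambda>s. C / real n * (ln (1 + m / s) - m / (s + m))) has_real_derivative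
        C / real n * (inverse (1 + m / s) * (- m / s\<^sup>2) + m / (s + m)\<^sup>2)) (at s)"
      using s pos by (auto intro!: derivative_eq_intros simp: power2_eq_square divide_inverse)
    also have "inverse (1 + m / s) * (- m / s\<^sup>2) + m / (s + m)\<^sup>2 = - (m\<^sup>2) / (s * (s + m)\<^sup>2)"
    proof -
      have "inverse (1 + m / s) * (- m / s\<^sup>2) = - m / (s * (s + m))"
        using s pos by (simp add: power2_eq_square field_simps)
      also have "\<dots> + m / (s + m)\<^sup>2 = - (m\<^sup>2) / (s * (s + m)\<^sup>2)"
        using s pos by (simp add: power2_eq_square divide_simps) (simp add: algebra_simps)
      finally show ?thesis .
    qed
    finally show "(\<rho>1 has_real_derivative \<rho>2 s) (at s)" by (simp add: \<rho>1_def[abs_def] \<rho>2_def)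
    \<comment> \<open>The inequality ln y \<le> y - 1 at y = 1 / (1 + m / s) gives ln (1 + m / s)
      \<ge> m / (s + m), the sign of the first derivative.\<close>
    have "ln (1 / (1 + m / s)) \<le> 1 / (1 + m / s) - 1" using pos by (intro ln_le_minus_one) auto
    also have "1 / (1 + m / s) - 1 = - (m / (s + m))" using s pos by (simp add: field_simps)
    finally show "\<rho>1 s \<ge> 0" using pos C by (simp add: \<rho>1_def ln_div)
    have "- (m\<^sup>2) / (s * (s + m)\<^sup>2) \<le> 0" using s by (simp add: divide_nonpos_nonneg)
    then show "\<rho>2 s \<le> 0" using C unfolding \<rho>2_def by (intro mult_nonneg_nonpos) auto
  qed
  ultimately show ?thesis unfolding crip_function_def by blast
qed

section \<open>Norms in coordinates and the reduction to rational vectors\<close>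

lemma l2_norm_eq: "x \<in> carrier_vec p \<Longrightarrow> l2_norm x = sqrt (\<Sum>i<p. (x $ i)\<^sup>2)"
  by (simp add: l2_norm_def L2_set_def)

lemma mult_mat_vec_index:
  assumes "A \<in> carrier_mat n p" "x \<in> carrier_vec p" "i < n"
  shows "(A *\<^sub>v x) $ i = (\<Sum>j<p. A $$ (i, j) * x $ j)"
  using assms by (auto simp: scalar_prod_def lessThan_atLeast0 intro!: sum.cong)

lemma l2_norm_mult_mat_vec:
  assumes A: "A \<in> carrier_mat n p" and x: "x \<in> carrier_vec p"
  shows "l2_norm (A *\<^sub>v x) = sqrt (\<Sum>i<n. (\<Sum>j<p. A $$ (i, j) * x $ j)\<^sup>2)"
  using assms by (simp add: l2_norm_eq[OF mult_mat_vec_carrier[OF A x]] mult_mat_vec_index del: index_mult_mat_vec)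

text \<open>
  Rounding all coordinates down to multiples of \<open>1 / N\<close> keeps equal coordinates equal, so it leaves the cut
  unchanged for large \<open>N\<close>. Hence the isometry property need only be tested on countably many
  vectors.
\<close>

definition rational_vecs :: "nat \<Rightarrow> real vec set" where
  "rational_vecs p = vec p ` ({..<p} \<rightarrow>\<^sub>E \<rat>)"

lemma rational_vecs_carrier: "x \<in> rational_vecs p \<Longrightarrow> x \<in> carrier_vec p"
  unfolding rational_vecs_def by (metis imageE vec_carrier)

lemma countable_rational_vecs: "countable (rational_vecs p)"
  unfolding rational_vecs_def by (intro countable_image countable_PiE) (auto intro: countable_rat)

lemma rational_approx_same_cut:
  assumes x: "x \<in> carrier_vec p" and E: "simple_graph p E"
  obtains X where "\<And>N. X N \<in> rational_vecs p" "\<And>i. i < p \<Longrightarrow> (\<lambda>N. X N $ i) \<longlonglongrightarrow> x $ i"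
    "\<forall>\<^sub>F N in sequentially. grad_l0 E (X N) = grad_l0 E x"
proof -
  define q where "q = (\<lambda>N t. real_of_int \<lfloor>real (Suc N) * t\<rfloor> / real (Suc N))"
  define X where "X = (\<lambda>N. vec p (\<lambda>i. q N (x $ i)))"
  have rat: "X N \<in> rational_vecs p" for N
    unfolding rational_vecs_def
  proof (rule image_eqI)
    show "X N = vec p (restrict (\<lambda>i. q N (x $ i)) {..<p})" by (auto simp: X_def)
    show "restrict (\<lambda>i. q N (x $ i)) {..<p} \<in> {..<p} \<rightarrow>\<^sub>E \<rat>"
      by (auto simp: q_def intro!: Rats_divide)
  qed
  have q: "(\<lambda>N. q N t) \<longlonglongrightarrow> t" for t
  proof (rule LIM_zero_cancel, rule Lim_null_comparison)
    show "\<forall>\<^sub>F N in sequentially. norm (q N t - t) \<le> inverse (real (Suc N))"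
    proof (rule always_eventually, rule allI)
      fix N
      have "q N t - t = (real_of_int \<lfloor>real (Suc N) * t\<rfloor> - real (Suc N) * t) / real (Suc N)"
        by (simp add: q_def diff_divide_distrib)
      moreover have "\<bar>real_of_int \<lfloor>real (Suc N) * t\<rfloor> - real (Suc N) * t\<bar> \<le> 1" by linarith
      ultimately show "norm (q N t - t) \<le> inverse (real (Suc N))"
        by (simp add: divide_inverse abs_mult mult_left_le_one_le)
    qed
    show "(\<lambda>N. inverse (real (Suc N))) \<longlonglongrightarrow> 0" by (rule LIMSEQ_inverse_real_of_nat)
  qed
  have "\<forall>\<^sub>F N in sequentially. \<forall>e\<in>E. grad (X N) e \<noteq> 0 \<longleftrightarrow> grad x e \<noteq> 0"
  proof (rule eventually_ball_finite)
    show "finite E" using E by (auto simp: simple_graph_def intro: finite_subset)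
    show "\<forall>e\<in>E. \<forall>\<^sub>F N in sequentially. grad (X N) e \<noteq> 0 \<longleftrightarrow> grad x e \<noteq> 0"
    proof
      fix e assume "e \<in> E"
      then obtain i j where e: "e = (i, j)" "i < p" "j < p" using E by (auto simp: simple_graph_def)
      show "\<forall>\<^sub>F N in sequentially. grad (X N) e \<noteq> 0 \<longleftrightarrow> grad x e \<noteq> 0"
      proof (cases "x $ i = x $ j")
        case True
        then show ?thesis using e by (simp add: grad_def X_def)
      next
        case False
        \<comment> \<open>Unequal coordinates have a nonzero limiting difference, so their
          approximants are eventually separated; finitely many edges then share one
          threshold.\<close>
        have "(\<lambda>N. q N (x $ i) - q N (x $ j)) \<longlonglongrightarrow> x $ i - x $ j" by (intro tendsto_diff q)
        then have "\<forall>\<^sub>F N in sequentially. q N (x $ i) - q N (x $ j) \<noteq> 0"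
          using False by (intro tendsto_imp_eventually_ne) auto
        then show ?thesis using e False by (auto simp: grad_def X_def elim: eventually_mono)
      qed
    qed
  qed
  then have "\<forall>\<^sub>F N in sequentially. grad_l0 E (X N) = grad_l0 E x"
  proof eventually_elim
    case (elim N)
    then have "{e \<in> E. grad (X N) e \<noteq> 0} = {e \<in> E. grad x e \<noteq> 0}" by auto
    then show ?case by (simp add: grad_l0_def)
  qed
  moreover have "(\<lambda>N. X N $ i) \<longlonglongrightarrow> x $ i" if "i < p" for i
    using q[of "x $ i"] that by (simp add: X_def)
  ultimately show ?thesis using that rat by blast
qed

text \<open>Along the rational approximants the cut size, and with it the value of \<rho>, is
  eventually constant while both norms converge, so the two non-strict inequalities pass to the
  limit.\<close>

lemma cRIP_iff_rational:
  assumes E: "simple_graph p E" and A: "A \<in> carrier_mat n p"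
    and \<kappa>: "\<kappa> > 0" and \<rho>: "crip_function \<rho>"
  shows "cRIP n p E \<kappa> \<rho> A \<longleftrightarrow> (\<forall>x\<in>rational_vecs p. grad_l0 E x \<ge> 1 \<longrightarrow>
        (1 - \<kappa> - sqrt (\<rho> (real (grad_l0 E x)))) * l2_norm x \<le> l2_norm (A *\<^sub>v x) \<and>
        l2_norm (A *\<^sub>v x) \<le> (1 + \<kappa> + sqrt (\<rho> (real (grad_l0 E x)))) * l2_norm x)"
    (is "_ \<longleftrightarrow> (\<forall>x\<in>_. ?P x)")
proof
  assume "cRIP n p E \<kappa> \<rho> A"
  then show "\<forall>x\<in>rational_vecs p. ?P x"
    unfolding cRIP_def using rational_vecs_carrier by blast
next
  assume *: "\<forall>x\<in>rational_vecs p. ?P x"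
  have "?P x" if x: "x \<in> carrier_vec p" for x
  proof
    assume g: "grad_l0 E x \<ge> 1"
    obtain X where X: "\<And>N. X N \<in> rational_vecs p" "\<And>i. i < p \<Longrightarrow> (\<lambda>N. X N $ i) \<longlonglongrightarrow> x $ i"
      and ev: "\<forall>\<^sub>F N in sequentially. grad_l0 E (X N) = grad_l0 E x"
      using rational_approx_same_cut[OF x E] by blast
    have Xc: "X N \<in> carrier_vec p" for N using X(1) by (rule rational_vecs_carrier)
    have l1: "(\<lambda>N. l2_norm (X N)) \<longlonglongrightarrow> l2_norm x"
      unfolding l2_norm_eq[OF x] l2_norm_eq[OF Xc]
      by (intro tendsto_real_sqrt tendsto_sum tendsto_power X(2)) simp
    have l2: "(\<lambda>N. l2_norm (A *\<^sub>v X N)) \<longlonglongrightarrow> l2_norm (A *\<^sub>v x)"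
      unfolding l2_norm_mult_mat_vec[OF A x] l2_norm_mult_mat_vec[OF A Xc]
      by (intro tendsto_real_sqrt tendsto_sum tendsto_power tendsto_mult tendsto_const X(2)) simp
    have P: "\<forall>\<^sub>F N in sequentially.
        (1 - \<kappa> - sqrt (\<rho> (real (grad_l0 E x)))) * l2_norm (X N) \<le> l2_norm (A *\<^sub>v X N) \<and>
        l2_norm (A *\<^sub>v X N) \<le> (1 + \<kappa> + sqrt (\<rho> (real (grad_l0 E x)))) * l2_norm (X N)"
      using ev
    proof eventually_elim
      case (elim N)
      then show ?case using bspec[OF * X(1)[of N]] g by simp
    qed
    show "(1 - \<kappa> - sqrt (\<rho> (real (grad_l0 E x)))) * l2_norm x \<le> l2_norm (A *\<^sub>v x) \<and>
        l2_norm (A *\<^sub>v x) \<le> (1 + \<kappa> + sqrt (\<rho> (real (grad_l0 E x)))) * l2_norm x"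
    proof
      show "(1 - \<kappa> - sqrt (\<rho> (real (grad_l0 E x)))) * l2_norm x \<le> l2_norm (A *\<^sub>v x)"
        by (rule tendsto_le[OF _ l2 tendsto_mult_left[OF l1]]) (simp, rule eventually_mono[OF P], blast)
      show "l2_norm (A *\<^sub>v x) \<le> (1 + \<kappa> + sqrt (\<rho> (real (grad_l0 E x)))) * l2_norm x"
        by (rule tendsto_le[OF _ tendsto_mult_left[OF l1] l2]) (simp, rule eventually_mono[OF P], blast)
    qed
  qed
  then show "cRIP n p E \<kappa> \<rho> A" unfolding cRIP_def using A \<kappa> \<rho> by blast
qed

text \<open>\<open>measure\<close> is 0 outside the sigma-algebra, so a lower bound on the
  probability of the event rests on its measurability. By the reduction to rational vectors it is a
  countable intersection of measurable events.\<close>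

lemma sets_cRIP_event:
  assumes E: "simple_graph p E" and \<kappa>: "\<kappa> > 0" and \<rho>: "crip_function \<rho>"
    and a: "\<And>i j. i < n \<Longrightarrow> j < p \<Longrightarrow> (\<lambda>w. a i w j) \<in> borel_measurable M"
  shows "{w \<in> space M. cRIP n p E \<kappa> \<rho> (row_matrix n p a w)} \<in> sets M"
proof -
  have A: "row_matrix n p a w \<in> carrier_mat n p" for w by (simp add: row_matrix_def)
  have [measurable]: "(\<lambda>w. l2_norm (row_matrix n p a w *\<^sub>v x)) \<in> borel_measurable M" if x: "x \<in> rational_vecs p" for x
  proof -
    have xc: "x \<in> carrier_vec p" using x by (rule rational_vecs_carrier)
    have "l2_norm (row_matrix n p a w *\<^sub>v x)
        = sqrt (\<Sum>i<n. (\<Sum>j<p. a i w j / sqrt (real n) * x $ j)\<^sup>2)" for w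
      unfolding l2_norm_mult_mat_vec[OF A xc] by (simp add: row_matrix_def)
    then have "(\<lambda>w. l2_norm (row_matrix n p a w *\<^sub>v x))
        = (\<lambda>w. sqrt (\<Sum>i<n. (\<Sum>j<p. a i w j / sqrt (real n) * x $ j)\<^sup>2))"
      by (rule ext)
    also have "\<dots> \<in> borel_measurable M"
      using a by measurable
    finally show ?thesis .
  qed
  show ?thesis
    unfolding cRIP_iff_rational[OF E A \<kappa> \<rho>]
    by (intro sets.sets_Collect_countable_All' sets.sets_Collect_imp countable_rational_vecs) measurable
qed

subsection \<open>The deviation of the sample covariance\<close>

text \<open>The entries of A^T A - \<Sigma> when the rows of A are the vectors \<open>y i\<close>
  divided by \<open>sqrt n\<close>.\<close>

definition dev_matrix :: "nat \<Rightarrow> (nat \<Rightarrow> nat \<Rightarrow> real) \<Rightarrow> real mat \<Rightarrow> nat \<Rightarrow> nat \<Rightarrow> real" where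
  "dev_matrix n y \<Sigma> j k = (\<Sum>i<n. y i j * y i k) / real n - \<Sigma> $$ (j, k)"

lemma square_sum_eq_quad_form:
  "(\<Sum>j<p. v j * y j)\<^sup>2 = (\<Sum>j<p. \<Sum>k<p. y j * y k * v j * v k)" for v y :: "nat \<Rightarrow> real"
  by (simp add: power2_eq_square sum_product mult_ac)

lemma quad_form_dev_matrix:
  "quad_form p (dev_matrix n y \<Sigma>) v
    = (\<Sum>i<n. (\<Sum>j<p. v j * y i j)\<^sup>2) / real n - quad_form p (\<lambda>j k. \<Sigma> $$ (j, k)) v"
proof -
  have "(\<Sum>i<n. (\<Sum>j<p. v j * y i j)\<^sup>2) = (\<Sum>j<p. \<Sum>k<p. \<Sum>i<n. y i j * y i k * v j * v k)"
    unfolding square_sum_eq_quad_form by (subst sum.swap, rule sum.cong[OF refl], rule sum.swap)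
  then show ?thesis
    by (simp add: quad_form_def dev_matrix_def sum_divide_distrib left_diff_distrib sum_subtractf sum_distrib_right)
qed

section \<open>Moments of linear forms and tails of the deviation\<close>

context prob_space
begin

lemma indep_vars_coordinate_measurable:
  assumes "indep_vars (\<lambda>_. borel_vec p) a I" "i \<in> I" "j < p"
  shows "(\<lambda>w. a i w j) \<in> borel_measurable M"
proof -
  have "a i \<in> measurable M (borel_vec p)" using assms by (auto simp: indep_vars_def)
  moreover have "(\<lambda>x. x j) \<in> measurable (borel_vec p) borel"
    using assms by (intro measurable_component_singleton) auto
  ultimately show ?thesis by (rule measurable_compose)
qed

text \<open>Specialise the supremum to even orders r = 2 q: the bound K * sqrt r on the norm becomes
  (2 K^2 q)^q for the moment, and the absolute value disappears.\<close>

lemma psi2_norm_moment: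
  assumes X: "psi2_norm M p X \<le> ereal K" and K: "K > 0"
    and u: "u \<in> carrier_vec p" "l2_norm u = 1" and q: "q \<ge> 1"
  shows "integrable M (\<lambda>w. (\<Sum>j<p. u $ j * X w j) ^ (2 * q))"
    and "expectation (\<lambda>w. (\<Sum>j<p. u $ j * X w j) ^ (2 * q)) \<le> (2 * K\<^sup>2 * real q) ^ q"
proof -
  define Y where "Y = (\<lambda>w. u \<bullet> vec p (X w))"
  define r where "r = real (2 * q)"
  have r: "r \<ge> 1" "r > 0" using q by (auto simp: r_def)
  have Y: "Y w = (\<Sum>j<p. u $ j * X w j)" for w
    by (simp add: Y_def scalar_prod_def lessThan_atLeast0)
  have pw: "\<bar>Y w\<bar> powr r = (\<Sum>j<p. u $ j * X w j) ^ (2 * q)" for w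
    using q unfolding r_def by (subst powr_realpow') (auto simp: Y power_mult)
  have "ereal (r powr (- 1 / 2)) * Lq_norm M r Y \<le> psi2_norm M p X"
    unfolding psi2_norm_def Y_def using u r by (intro SUP_upper2[of u] SUP_upper) auto
  also note X
  finally have le: "ereal (r powr (- 1 / 2)) * Lq_norm M r Y \<le> ereal K" .
  have pos: "r powr (- 1 / 2) > 0" using r by simp
  \<comment> \<open>A moment that is not integrable has \<open>Lq_norm\<close> equal to \<infinity>,
    so the finite psi2 bound yields integrability.\<close>
  have int: "integrable M (\<lambda>w. \<bar>Y w\<bar> powr r)"
  proof (rule ccontr)
    assume "\<not> integrable M (\<lambda>w. \<bar>Y w\<bar> powr r)"
    then have "Lq_norm M r Y = \<infinity>" by (simp add: Lq_norm_def)
    then show False using le pos by simp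
  qed
  then show "integrable M (\<lambda>w. (\<Sum>j<p. u $ j * X w j) ^ (2 * q))" by (simp add: pw)
  define e where "e = expectation (\<lambda>w. \<bar>Y w\<bar> powr r)"
  have e0: "e \<ge> 0" unfolding e_def by (intro integral_nonneg_AE) auto
  have "r powr (- 1 / 2) * e powr (1 / r) \<le> K"
    using le int by (simp add: Lq_norm_def e_def)
  moreover have "r powr (- 1 / 2) = 1 / sqrt r"
    using r by (simp add: powr_minus_divide powr_half_sqrt)
  ultimately have "e powr (1 / r) / sqrt r \<le> K" by simp
  then have "e powr (1 / r) \<le> K * sqrt r" using r by (simp only: pos_divide_le_eq real_sqrt_gt_zero)
  then have "(e powr (1 / r)) powr r \<le> (K * sqrt r) powr r" using r by (intro powr_mono2) auto
  moreover have "(e powr (1 / r)) powr r = e" using e0 r by (simp add: powr_powr)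
  moreover have "(K * sqrt r) powr r = (2 * K\<^sup>2 * real q) ^ q"
  proof -
    have "(K * sqrt r) powr r = (K * sqrt r) ^ (2 * q)"
      unfolding r_def using K q by (subst powr_realpow) auto
    also have "\<dots> = (K\<^sup>2 * r) ^ q" using r by (simp add: power_mult power_mult_distrib)
    finally show ?thesis by (simp add: r_def mult_ac)
  qed
  ultimately show "expectation (\<lambda>w. (\<Sum>j<p. u $ j * X w j) ^ (2 * q)) \<le> (2 * K\<^sup>2 * real q) ^ q"
    by (simp add: e_def pw)
qed

text \<open>By homogeneity the moment is N^q times that of the normalised vector, and N \<le> 1.
  Points of the net lie in the ball and need not have norm 1, hence this version.\<close>

lemma psi2_norm_moment_ball:
  assumes X: "psi2_norm M p X \<le> ereal K" and K: "K > 0"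
    and v: "(\<Sum>i<p. (v i)\<^sup>2) \<le> 1" and q: "q \<ge> 1"
  shows "integrable M (\<lambda>w. (\<Sum>j<p. v j * X w j) ^ (2 * q))"
    and "expectation (\<lambda>w. (\<Sum>j<p. v j * X w j) ^ (2 * q)) \<le> (2 * K\<^sup>2 * real q) ^ q"
proof -
  define N where "N = (\<Sum>i<p. (v i)\<^sup>2)"
  have "integrable M (\<lambda>w. (\<Sum>j<p. v j * X w j) ^ (2 * q)) \<and>
    expectation (\<lambda>w. (\<Sum>j<p. v j * X w j) ^ (2 * q)) \<le> (2 * K\<^sup>2 * real q) ^ q"
  proof (cases "N = 0")
    case True
    \<comment> \<open>The zero vector cannot be normalised; its moments vanish because q \<ge>
      1.\<close>
    then have "v j = 0" if "j < p" for j
      using that by (simp add: N_def sum_nonneg_eq_0_iff)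
    then show ?thesis using q by (simp add: power_0_left)
  next
    case False
    then have N: "N > 0" by (simp add: N_def less_le sum_nonneg)
    define u where "u = vec p (\<lambda>i. v i / sqrt N)"
    have uc: "u \<in> carrier_vec p" by (simp add: u_def)
    have "(\<Sum>i<p. (u $ i)\<^sup>2) = (\<Sum>i<p. (v i)\<^sup>2 / N)"
      using N by (simp add: u_def power_divide)
    also have "\<dots> = N / N" unfolding N_def by (rule sum_divide_distrib[symmetric])
    finally have un: "l2_norm u = 1" using N by (simp add: l2_norm_eq[OF uc])
    have "(\<Sum>j<p. v j * X w j) = sqrt N * (\<Sum>j<p. u $ j * X w j)" for w
      using N by (simp add: u_def sum_distrib_left)
    then have eq: "(\<Sum>j<p. v j * X w j) ^ (2 * q) = N ^ q * (\<Sum>j<p. u $ j * X w j) ^ (2 * q)" for w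
      using N by (simp add: power_mult_distrib power_mult)
    note m = psi2_norm_moment[OF X K uc un q]
    have "N ^ q * expectation (\<lambda>w. (\<Sum>j<p. u $ j * X w j) ^ (2 * q)) \<le> 1 * (2 * K\<^sup>2 * real q) ^ q"
      using m(2) v N by (intro mult_mono power_le_one) (auto simp: N_def power_mult)
    then show ?thesis using m(1) unfolding eq by simp
  qed
  then show "integrable M (\<lambda>w. (\<Sum>j<p. v j * X w j) ^ (2 * q))"
    and "expectation (\<lambda>w. (\<Sum>j<p. v j * X w j) ^ (2 * q)) \<le> (2 * K\<^sup>2 * real q) ^ q" by auto
qed

text \<open>Zero mean turns covariances into second moments, so expanding the square gives the form
  of the covariance matrix. The psi2 bound at coordinate vectors supplies the square integrability
  that makes the products integrable.\<close>

lemma expectation_linear_form_square: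
  assumes meas: "\<And>j. j < p \<Longrightarrow> (\<lambda>w. X w j) \<in> borel_measurable M"
    and X: "psi2_norm M p X \<le> ereal K" and K: "K > 0" and mz: "mean_zero M p X"
  shows "expectation (\<lambda>w. (\<Sum>j<p. v j * X w j)\<^sup>2) = quad_form p (\<lambda>j k. cov_mat M p X $$ (j, k)) v"
proof -
  have sq: "integrable M (\<lambda>w. (X w j)\<^sup>2)" if j: "j < p" for j
  proof -
    have "(\<Sum>i<p. ((if i = j then 1 else 0 :: real))\<^sup>2) \<le> 1"
      by (simp add: if_distrib[of "\<lambda>x. x\<^sup>2"] cong: if_cong)
    from psi2_norm_moment_ball(1)[OF X K this, of 1] j show ?thesis
      by (simp add: if_distrib[of "\<lambda>x. x * _"] cong: if_cong)
  qed
  have int: "integrable M (\<lambda>w. X w j * X w k)" if "j < p" "k < p" for j k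
  proof (rule Bochner_Integration.integrable_bound)
    show "integrable M (\<lambda>w. (X w j)\<^sup>2 + (X w k)\<^sup>2)" using sq that by auto
    show "(\<lambda>w. X w j * X w k) \<in> borel_measurable M" using meas that by auto
    show "AE w in M. norm (X w j * X w k) \<le> norm ((X w j)\<^sup>2 + (X w k)\<^sup>2)"
    proof (rule AE_I2)
      fix w
      have "2 * (\<bar>X w j\<bar> * \<bar>X w k\<bar>) \<le> (X w j)\<^sup>2 + (X w k)\<^sup>2"
        using sum_squares_bound[of "\<bar>X w j\<bar>" "\<bar>X w k\<bar>"] by (simp add: mult.assoc)
      moreover have "0 \<le> \<bar>X w j\<bar> * \<bar>X w k\<bar>" by simp
      ultimately show "norm (X w j * X w k) \<le> norm ((X w j)\<^sup>2 + (X w k)\<^sup>2)"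
        unfolding real_norm_def abs_mult by (intro order_trans[OF _ abs_ge_self]) linarith
    qed
  qed
  have "expectation (\<lambda>w. (\<Sum>j<p. v j * X w j)\<^sup>2)
      = (\<Sum>j<p. expectation (\<lambda>w. \<Sum>k<p. X w j * X w k * v j * v k))"
    unfolding square_sum_eq_quad_form
    by (intro Bochner_Integration.integral_sum Bochner_Integration.integrable_sum integrable_mult_left int) auto
  also have "\<dots> = (\<Sum>j<p. \<Sum>k<p. expectation (\<lambda>w. X w j * X w k * v j * v k))"
    by (intro sum.cong refl Bochner_Integration.integral_sum integrable_mult_left int) auto
  also have "\<dots> = quad_form p (\<lambda>j k. cov_mat M p X $$ (j, k)) v"
    unfolding quad_form_def using mz by (intro sum.cong refl) (simp add: cov_mat_def mean_zero_def)
  finally show ?thesis .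
qed

text \<open>After multiplication by \<open>n\<close> the form is a sum of independent centred
  squares, because the linear form of each row has second moment equal to the form of \<Sigma> at
  \<open>v\<close>. Bernstein's inequality applies to it.\<close>

lemma prob_quad_form_dev_matrix_ge:
  assumes ind: "indep_vars (\<lambda>_. borel_vec p) a {..<n}" and n: "n \<ge> 1" and K: "K > 0" and b: "b > 0"
    and a: "\<And>i. i < n \<Longrightarrow> mean_zero M p (a i) \<and> cov_mat M p (a i) = \<Sigma> \<and> psi2_norm M p (a i) \<le> ereal K"
    and v: "(\<Sum>i<p. (v i)\<^sup>2) \<le> 1"
  defines "B \<equiv> {w \<in> space M. 8 * exp 1 * K\<^sup>2 * max (sqrt b) b
      \<le> \<bar>quad_form p (dev_matrix n (\<lambda>i. a i w) \<Sigma>) v\<bar>}"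
  shows "B \<in> sets M" and "prob B \<le> 2 * exp (- real n * b)"
proof -
  define Y where "Y = (\<lambda>i w. \<Sum>j<p. v j * a i w j)"
  have am: "(\<lambda>w. a i w j) \<in> borel_measurable M" if "i < n" "j < p" for i j
    using indep_vars_coordinate_measurable[OF ind] that by simp
  have indY: "indep_vars (\<lambda>_. borel) Y {..<n}"
    unfolding Y_def
    by (rule indep_vars_compose2[OF ind])
      (intro borel_measurable_sum borel_measurable_times borel_measurable_const measurable_component_singleton, simp)
  have [measurable]: "Y i \<in> borel_measurable M" if "i < n" for i
    using indY that by (auto simp: indep_vars_def)
  have EY: "expectation (\<lambda>w. (Y i w)\<^sup>2) = quad_form p (\<lambda>j k. \<Sigma> $$ (j, k)) v" if "i < n" for i
    using expectation_linear_form_square[of p "a i" K v] am a K that by (auto simp: Y_def)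
  have eq: "real n * quad_form p (dev_matrix n (\<lambda>i. a i w) \<Sigma>) v
      = (\<Sum>i<n. (Y i w)\<^sup>2 - expectation (\<lambda>w. (Y i w)\<^sup>2))" for w
    using n EY by (simp add: quad_form_dev_matrix sum_subtractf right_diff_distrib) (simp add: Y_def)
  have B: "B = {w \<in> space M. real (card {..<n}) * (8 * exp 1 * K\<^sup>2 * max (sqrt b) b)
      \<le> \<bar>\<Sum>i<n. (Y i w)\<^sup>2 - expectation (\<lambda>w. (Y i w)\<^sup>2)\<bar>}"
    using n unfolding B_def eq[symmetric] by (simp add: abs_mult mult.assoc)
  show "B \<in> sets M" unfolding B by measurable
  have "prob B \<le> 2 * exp (- real (card {..<n}) * b)"
    unfolding B using a K psi2_norm_moment_ball[OF _ K v]
    by (intro prob_sum_centred_squares_ge indY b) (auto simp: Y_def)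
  then show "prob B \<le> 2 * exp (- real n * b)" by simp
qed

end

text \<open>The choice of a cut costs exp (l + s), its net exp (54 s) and the factor 2 another exp
  s. Since s \<le> 2 l, the total exponent 56 s + l is at most 113 l, and 114 + k leaves a decay of
  exp (- (k + 1) l).\<close>

lemma cut_entropy_bound:
  assumes s: "1 \<le> s" "s \<le> m" and k: "k > (0::real)"
  defines "l \<equiv> real s * ln (1 + real m / real s)"
  shows "real (m choose s) * ((3 * 2 ^ 16) ^ (3 * s) * (2 * exp (- ((114 + k) * l)))) \<le> real (1 + m) powr (- (k + 1))"
proof -
  have s0: "real s > 0" using s by simp
  have el: "exp l = (1 + real m / real s) ^ s"
    using s0 by (simp add: l_def exp_of_nat_mult add_pos_nonneg)
  \<comment> \<open>As s \<le> m, each cut edge contributes at least ln 2 > 1/2 to \<open>l\<close>,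
    so every cost linear in \<open>s\<close> can be paid out of \<open>l\<close>.\<close>
  have "ln 2 \<le> ln (1 + real m / real s)" using s by (intro ln_mono) auto
  then have "1 / 2 \<le> ln (1 + real m / real s)" using ln2_ge_two_thirds by linarith
  then have sl: "real s \<le> 2 * l" using s0 by (simp add: l_def field_simps)
  have "real (m choose s) * fact s \<le> real m ^ s"
    using binomial_fact_pow[of m s] by (metis of_nat_fact of_nat_le_iff of_nat_mult of_nat_power)
  then have "real (m choose s) \<le> real m ^ s / fact s" by (simp add: field_simps)
  also have "\<dots> = (real m / real s) ^ s * (real s ^ s / fact s)" using s0 by (simp add: power_divide)
  also have "\<dots> \<le> exp l * exp (real s)"
    unfolding el using power_div_fact_le[of s] s0
    by (intro mult_mono power_mono) (auto simp: exp_of_nat_mult[of s 1, simplified])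
  finally have b1: "real (m choose s) \<le> exp (l + real s)" by (simp add: exp_add)
  have e2: "(2::real) \<le> exp 1" using exp_ge_add_one_self[of 1] by simp
  \<comment> \<open>Replacing 3 by 4 gives 18 factors 2 \<le> exp 1 per block; with 3 s blocks the
    exponent is 54 s.\<close>
  have "(3 * 2 ^ 16 :: real) \<le> 2 ^ 18" by simp
  also have "\<dots> \<le> exp 1 ^ 18" using e2 by (intro power_mono) auto
  finally have "(3 * 2 ^ 16 :: real) ^ (3 * s) \<le> (exp 1 ^ 18) ^ (3 * s)" by (intro power_mono) auto
  also have "\<dots> = exp (54 * real s)"
    by (simp flip: power_mult exp_of_nat_mult)
  finally have b2: "(3 * 2 ^ 16 :: real) ^ (3 * s) \<le> exp (54 * real s)" .
  have "(2::real) \<le> exp (real s)" using e2 s by (intro order_trans[OF e2]) auto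
  then have b3: "2 * exp (- ((114 + k) * l)) \<le> exp (real s) * exp (- ((114 + k) * l))"
    by (intro mult_right_mono) auto
  have "real (m choose s) * ((3 * 2 ^ 16) ^ (3 * s) * (2 * exp (- ((114 + k) * l))))
      \<le> exp (l + real s) * (exp (54 * real s) * (exp (real s) * exp (- ((114 + k) * l))))"
    by (intro mult_mono b1 b2 b3) auto
  also have "\<dots> = exp (56 * real s + l - (114 + k) * l)"
    by (simp flip: exp_add add: algebra_simps)
  also have "\<dots> \<le> exp (- (k + 1) * l)"
    using sl by (simp add: algebra_simps)
  also have "\<dots> \<le> exp (- (k + 1) * ln (real (1 + m)))"
  proof -
    \<comment> \<open>Bernoulli's inequality gives l \<ge> ln (1 + m) for every \<open>s\<close>, so
      the remaining decay is a power of 1 + m uniformly in the cut size.\<close>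
    have "1 + real s * (real m / real s) \<le> (1 + real m / real s) ^ s"
      by (rule Bernoulli_inequality) (rule order_trans[of _ 0], auto)
    then have "real (1 + m) \<le> exp l" using s0 unfolding el by simp
    then have "ln (real (1 + m)) \<le> l" using ln_mono[of "real (1 + m)" "exp l"] by simp
    then show ?thesis using k by (simp add: mult_left_mono)
  qed
  also have "\<dots> = real (1 + m) powr (- (k + 1))" by (simp add: powr_def)
  finally show ?thesis .
qed

text \<open>Here \<open>h\<close> stands for \<open>sqrt b\<close>, \<open>N\<close> for the squared
  norm of x, \<open>Q\<close> for the form of \<Sigma> and \<open>q\<close> for the squared norm of
  A x. The choice of \<open>H\<close> gives H \<ge> 1, H \<ge> g and (1 - \<kappa>) H \<ge> g.
  Above, the cross term 2 (1 + \<kappa>) H h absorbs g h, and (H h)^2 absorbs g h^2. Below, in the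
  nontrivial case, (1 - \<kappa> - H h)^2 is at most (1 - \<kappa>)^2 - (1 - \<kappa>) H h.\<close>

lemma restricted_isometry_from_deviation:
  fixes \<kappa> g h N q Q :: real
  assumes \<kappa>: "0 < \<kappa>" "\<kappa> < 1" and g: "g \<ge> 0" and h: "h \<ge> 0" and N: "N \<ge> 0" and q: "q \<ge> 0"
    and Q: "(1 - \<kappa>)\<^sup>2 * N \<le> Q" "Q \<le> (1 + \<kappa>)\<^sup>2 * N"
    and dev: "\<bar>q - Q\<bar> \<le> g * max h (h\<^sup>2) * N"
  defines "H \<equiv> 1 + g / (1 - \<kappa>)"
  shows "(1 - \<kappa> - H * h) * sqrt N \<le> sqrt q" and "sqrt q \<le> (1 + \<kappa> + H * h) * sqrt N"
proof -
  have "g \<le> g / (1 - \<kappa>)" using g \<kappa> by (simp add: le_divide_eq mult_left_le)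
  then have H: "H \<ge> 1" "g \<le> H" using g \<kappa> by (auto simp: H_def)
  have HH: "H \<le> H\<^sup>2" using H by (simp add: power2_eq_square)
  have Hg: "g \<le> (1 - \<kappa>) * H" using \<kappa> by (simp add: H_def distrib_left)
  have Hh: "H * h \<ge> 0" using H h by simp
  have "g * max h (h\<^sup>2) \<le> 2 * (1 + \<kappa>) * (H * h) + (H * h)\<^sup>2"
  proof (cases "h\<^sup>2 \<le> h")
    case True
    have "g * h \<le> H * h" using H h by (intro mult_right_mono)
    also have "\<dots> \<le> 2 * (1 + \<kappa>) * (H * h)" using Hh \<kappa> mult_right_mono[of 1 "2 * (1 + \<kappa>)" "H * h"] by simp
    finally show ?thesis using True by (simp add: max_def add_increasing2)
  next
    case False
    have "g * h\<^sup>2 \<le> H\<^sup>2 * h\<^sup>2" using H HH by (intro mult_right_mono) auto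
    moreover have "0 \<le> 2 * (1 + \<kappa>) * (H * h)" using \<kappa> by (intro mult_nonneg_nonneg[OF _ Hh]) simp
    ultimately show ?thesis using False by (simp add: max_def power_mult_distrib add_increasing)
  qed
  then have "(1 + \<kappa>)\<^sup>2 + g * max h (h\<^sup>2) \<le> (1 + \<kappa> + H * h)\<^sup>2"
    by (simp add: power2_eq_square algebra_simps)
  then have "((1 + \<kappa>)\<^sup>2 + g * max h (h\<^sup>2)) * N \<le> (1 + \<kappa> + H * h)\<^sup>2 * N"
    using N by (rule mult_right_mono)
  moreover have "q \<le> ((1 + \<kappa>)\<^sup>2 + g * max h (h\<^sup>2)) * N"
    using Q dev by (simp add: distrib_right)
  ultimately have "sqrt q \<le> sqrt ((1 + \<kappa> + H * h)\<^sup>2 * N)" by (intro real_sqrt_le_mono) linarith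
  then show "sqrt q \<le> (1 + \<kappa> + H * h) * sqrt N" using \<kappa> Hh by (simp add: real_sqrt_mult)
  show "(1 - \<kappa> - H * h) * sqrt N \<le> sqrt q"
  \<comment> \<open>A nonpositive left factor makes the claim trivial. Otherwise H h < 1 - \<kappa>
    with H \<ge> 1 forces h \<le> 1, so the deviation is linear in \<open>h\<close>.\<close>
  proof (cases "1 - \<kappa> - H * h \<le> 0")
    case True
    then have "(1 - \<kappa> - H * h) * sqrt N \<le> 0" using N by (intro mult_nonpos_nonneg) auto
    then show ?thesis using q by (meson order_trans real_sqrt_ge_zero)
  next
    case False
    have "1 * h \<le> H * h" using H h by (intro mult_right_mono)
    then have "h \<le> 1" using False \<kappa> by linarith
    then have "h\<^sup>2 \<le> h" using h by (simp add: power2_eq_square mult_left_le_one_le)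
    then have mx: "max h (h\<^sup>2) = h" by (simp add: max_def)
    have "(H * h)\<^sup>2 \<le> (1 - \<kappa>) * (H * h)"
      unfolding power2_eq_square using False Hh by (intro mult_right_mono) auto
    moreover have "g * h \<le> (1 - \<kappa>) * H * h" using Hg h by (intro mult_right_mono)
    ultimately have "(1 - \<kappa> - H * h)\<^sup>2 \<le> (1 - \<kappa>)\<^sup>2 - g * h"
      by (simp add: power2_eq_square algebra_simps)
    then have "(1 - \<kappa> - H * h)\<^sup>2 * N \<le> ((1 - \<kappa>)\<^sup>2 - g * h) * N" using N by (rule mult_right_mono)
    moreover have "((1 - \<kappa>)\<^sup>2 - g * h) * N \<le> q"
      using Q dev unfolding mx by (simp add: left_diff_distrib)
    ultimately have "sqrt ((1 - \<kappa> - H * h)\<^sup>2 * N) \<le> sqrt q" by (intro real_sqrt_le_mono) linarith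
    then show ?thesis using False by (simp add: real_sqrt_mult)
  qed
qed

subsection \<open>The union bound\<close>

theorem proposition3p2:
  fixes K \<kappa> k :: real
  assumes "K > 0" and "0 < \<kappa>" and "\<kappa> < 1" and "k > 0"
  shows "\<exists>C>0. \<forall>(n::nat) (p::nat) (E :: (nat \<times> nat) set) (M :: 'w measure)
            (a :: nat \<Rightarrow> 'w \<Rightarrow> nat \<Rightarrow> real) (\<Sigma> :: real mat).
          n \<ge> 1 \<longrightarrow> p \<ge> 3 \<longrightarrow> connected_graph p E \<longrightarrow>
          prob_space M \<longrightarrow> iid_vectors M n p a \<longrightarrow>
          (\<forall>i<n. mean_zero M p (a i) \<and> cov_mat M p (a i) = \<Sigma> \<and> psi2_norm M p (a i) \<le> ereal K) \<longrightarrow>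
          sigma_max \<Sigma> \<le> (1 + \<kappa>)^2 \<longrightarrow> sigma_min \<Sigma> \<ge> (1 - \<kappa>)^2 \<longrightarrow>
          measure M {w \<in> space M. cRIP n p E \<kappa> (rho_log C n E) (row_matrix n p a w)}
            \<ge> 1 - real (card E) powr (- k)"
proof -
  \<comment> \<open>The factor 8 e K^2 comes from Bernstein's inequality, the 3 from the passage
    from the net to the whole space.\<close>
  define g where "g = 3 * (8 * exp 1 * K\<^sup>2)"
  define H where "H = 1 + g / (1 - \<kappa>)"
  \<comment> \<open>The multiple of the entropy term required by
    \<open>cut_entropy_bound\<close>.\<close>
  define c where "c = 114 + k"
  have g: "g \<ge> 0" by (simp add: g_def)
  then have H: "H > 0" using assms by (simp add: H_def add_pos_nonneg)
  have c: "c > 0" using assms by (simp add: c_def)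
  show ?thesis
  \<comment> \<open>With this constant the square root of \<rho> at a cut of size s is exactly
    \<open>H * sqrt (b s)\<close>: \<open>c\<close> pays for the union bound and \<open>H\<close>
    for taking square roots.\<close>
  proof (intro exI[of _ "c * H\<^sup>2"] conjI allI impI)
    show "c * H\<^sup>2 > 0" using c H by simp
    fix n p :: nat and E :: "(nat \<times> nat) set" and M :: "'w measure"
      and a :: "nat \<Rightarrow> 'w \<Rightarrow> nat \<Rightarrow> real" and \<Sigma> :: "real mat"
    assume n: "n \<ge> 1" and p: "p \<ge> 3" and G: "connected_graph p E" and M: "prob_space M"
      and iid: "iid_vectors M n p a"
      and a: "\<forall>i<n. mean_zero M p (a i) \<and> cov_mat M p (a i) = \<Sigma> \<and> psi2_norm M p (a i) \<le> ereal K"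
      and smax: "sigma_max \<Sigma> \<le> (1 + \<kappa>)^2" and smin: "sigma_min \<Sigma> \<ge> (1 - \<kappa>)^2"
    interpret prob_space M by fact
    have a': "mean_zero M p (a i) \<and> cov_mat M p (a i) = \<Sigma> \<and> psi2_norm M p (a i) \<le> ereal K" if "i < n" for i
      using a that by blast
    have ind: "indep_vars (\<lambda>_. borel_vec p) a {..<n}" using iid by (simp add: iid_vectors_def)
    have simple: "simple_graph p E" using G by (simp add: connected_graph_def)
    have finE: "finite E" using simple by (rule simple_graph_finite)
    \<comment> \<open>Row 0 exists because n \<ge> 1; it determines the dimension and the symmetry
      of \<Sigma>.\<close>
    have \<Sigma>: "\<Sigma> = cov_mat M p (a 0)" using a n by auto
    have \<Sigma>c: "\<Sigma> \<in> carrier_mat p p" by (simp add: \<Sigma> cov_mat_def)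
    have sym: "\<Sigma> $$ (i, j) = \<Sigma> $$ (j, i)" if "i < p" "j < p" for i j
      using that by (simp add: \<Sigma> cov_mat_def mult.commute)
    define m where "m = card E"
    define b where "b = (\<lambda>s. c * (real s * ln (1 + real m / real s)) / real n)"
    define \<eta> where "\<eta> = (\<lambda>s. 8 * exp 1 * K\<^sup>2 * max (sqrt (b s)) (b s))"
    have m: "m \<ge> 1" using connected_graph_card_pos[OF G] p by (simp add: m_def)
    have b: "b s > 0" if "s \<in> {1..m}" for s
      unfolding b_def using that c n by (intro divide_pos_pos mult_pos_pos ln_gt_zero) auto
    define retr where "retr = (\<lambda>F r. card (r ` {..<p}) \<le> 2 * card F + 1 \<and>
      (\<forall>x :: nat \<Rightarrow> real. (\<forall>(u, v)\<in>E - F. x u = x v) \<longrightarrow> (\<forall>i<p. x i = x (r i))))"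
    have "\<exists>r. retr F r" if "F \<subseteq> E" for F
      unfolding retr_def using p by (intro connected_graph_cut_retraction[OF G _ that]) simp
    \<comment> \<open>One retraction is fixed for each edge set, independently of the sample point,
      so that \<open>Bad\<close> below is a finite union of events.\<close>
    then obtain R where R: "\<And>F. F \<subseteq> E \<Longrightarrow> retr F (R F)" by metis
    define Ev where "Ev = (\<lambda>s v. {w \<in> space M. \<eta> s \<le> \<bar>quad_form p (dev_matrix n (\<lambda>i. a i w) \<Sigma>) v\<bar>})"
    define Cuts where "Cuts = (\<lambda>s. {F. F \<subseteq> E \<and> card F = s})"
    define Bad where "Bad = (\<Union>s\<in>{1..m}. \<Union>F\<in>Cuts s. \<Union>v\<in>fibre_net p (R F). Ev s v)"
    have finC: "finite (Cuts s)" for s unfolding Cuts_def using finE by auto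
    have Ev: "Ev s v \<in> sets M" "prob (Ev s v) \<le> 2 * exp (- real n * b s)"
      if "s \<in> {1..m}" "v \<in> fibre_net p r" for s v r
    proof -
      note D = prob_quad_form_dev_matrix_ge[OF ind n assms(1) b[OF that(1)] a' fibre_net_norm[OF that(2)]]
      show "Ev s v \<in> sets M" unfolding Ev_def \<eta>_def by (rule D(1))
      show "prob (Ev s v) \<le> 2 * exp (- real n * b s)" unfolding Ev_def \<eta>_def by (rule D(2))
    qed
    have cut: "prob (\<Union>v\<in>fibre_net p (R F). Ev s v) \<le> (3 * 2 ^ 16) ^ (3 * s) * (2 * exp (- real n * b s))"
      if s: "s \<in> {1..m}" and F: "F \<in> Cuts s" for s F
    proof -
      have "prob (\<Union>v\<in>fibre_net p (R F). Ev s v) \<le> (\<Sum>v\<in>fibre_net p (R F). prob (Ev s v))"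
        using Ev(1)[OF s] by (intro measure_UNION_le finite_fibre_net) auto
      also have "\<dots> \<le> (\<Sum>v\<in>fibre_net p (R F). 2 * exp (- real n * b s))"
        using Ev(2)[OF s] by (intro sum_mono) auto
      also have "\<dots> = real (card (fibre_net p (R F))) * (2 * exp (- real n * b s))" by simp
      also have "\<dots> \<le> (3 * 2 ^ 16) ^ (3 * s) * (2 * exp (- real n * b s))"
      proof (intro mult_right_mono)
        \<comment> \<open>Since s \<ge> 1, the 2 s + 1 blocks are at most 3 s.\<close>
        have "card (R F ` {..<p}) \<le> 3 * s" using R[of F] F s by (auto simp: Cuts_def retr_def)
        then have "(3 * 2 ^ 16 :: real) ^ card (R F ` {..<p}) \<le> (3 * 2 ^ 16) ^ (3 * s)"
          by (intro power_increasing) auto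
        then show "real (card (fibre_net p (R F))) \<le> (3 * 2 ^ 16) ^ (3 * s)"
          using card_fibre_net[of p "R F"] by linarith
      qed simp
      finally show ?thesis .
    qed
    have level: "prob (\<Union>F\<in>Cuts s. \<Union>v\<in>fibre_net p (R F). Ev s v) \<le> real m powr (- (k + 1))"
      if s: "s \<in> {1..m}" for s
    proof -
      have nb: "- real n * b s = - ((114 + k) * (real s * ln (1 + real m / real s)))"
        using n by (simp add: b_def c_def)
      have "prob (\<Union>F\<in>Cuts s. \<Union>v\<in>fibre_net p (R F). Ev s v)
          \<le> (\<Sum>F\<in>Cuts s. prob (\<Union>v\<in>fibre_net p (R F). Ev s v))"
        using Ev(1)[OF s] by (intro measure_UNION_le finC sets.finite_UN finite_fibre_net) auto
      also have "\<dots> \<le> (\<Sum>F\<in>Cuts s. (3 * 2 ^ 16) ^ (3 * s) * (2 * exp (- real n * b s)))"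
        using cut[OF s] by (intro sum_mono) auto
      also have "\<dots> = real (m choose s) * ((3 * 2 ^ 16) ^ (3 * s) * (2 * exp (- real n * b s)))"
        using n_subsets[OF finE, of s] by (simp add: Cuts_def m_def)
      also have "\<dots> \<le> real (1 + m) powr (- (k + 1))"
        unfolding nb using s assms(4) by (intro cut_entropy_bound) auto
      also have "\<dots> \<le> real m powr (- (k + 1))"
        using m assms(4) by (intro powr_mono2') auto
      finally show ?thesis .
    qed
    have Bad_sets: "Bad \<in> sets M"
      unfolding Bad_def using Ev(1) by (intro sets.finite_UN finC finite_fibre_net) auto
    have "prob Bad \<le> (\<Sum>s\<in>{1..m}. prob (\<Union>F\<in>Cuts s. \<Union>v\<in>fibre_net p (R F). Ev s v))"
      unfolding Bad_def using Ev(1) by (intro measure_UNION_le sets.finite_UN finC finite_fibre_net) auto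
    \<comment> \<open>The additional 1 in the exponent k + 1 pays for summing over the m possible
      cut sizes.\<close>
    also have "\<dots> \<le> (\<Sum>s\<in>{1..m}. real m powr (- (k + 1)))" by (intro sum_mono level)
    also have "\<dots> = real m powr 1 * real m powr (- (k + 1))" using m by simp
    also have "\<dots> = real m powr (- k)" unfolding powr_add[symmetric] by simp
    finally have Bad: "prob Bad \<le> real m powr (- k)" .

    let ?good = "{w \<in> space M. cRIP n p E \<kappa> (rho_log (c * H\<^sup>2) n E) (row_matrix n p a w)}"
    have crip: "crip_function (rho_log (c * H\<^sup>2) n E)"
      using c by (intro crip_function_rho_log) simp
    have good: "?good \<in> sets M"
      using indep_vars_coordinate_measurable[OF ind] by (intro sets_cRIP_event simple assms(2) crip) auto
    \<comment> \<open>From here on the argument is deterministic: outside \<open>Bad\<close> the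
      deviation is small at every net point of every edge set, in particular for the cut of any
      given \<open>x\<close>.\<close>
    have "space M - Bad \<subseteq> ?good"
    proof (intro subsetI CollectI conjI)
      fix w assume w: "w \<in> space M - Bad"
      then show "w \<in> space M" by simp
      have A: "row_matrix n p a w \<in> carrier_mat n p" by (simp add: row_matrix_def)
      have "(1 - \<kappa> - sqrt (rho_log (c * H\<^sup>2) n E (real (grad_l0 E x)))) * l2_norm x \<le> l2_norm (row_matrix n p a w *\<^sub>v x) \<and>
        l2_norm (row_matrix n p a w *\<^sub>v x) \<le> (1 + \<kappa> + sqrt (rho_log (c * H\<^sup>2) n E (real (grad_l0 E x)))) * l2_norm x"
        if x: "x \<in> carrier_vec p" and gx: "grad_l0 E x \<ge> 1" for x
      proof -
        define F where "F = {e \<in> E. grad x e \<noteq> 0}"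
        define s where "s = card F"
        have FE: "F \<subseteq> E" by (auto simp: F_def)
        have s: "s \<in> {1..m}" "grad_l0 E x = s"
          using gx card_mono[OF finE FE] by (auto simp: s_def F_def grad_l0_def m_def)
        have "\<forall>(u, v)\<in>E - F. x $ u = x $ v" by (auto simp: F_def grad_def)
        then have "\<forall>i<p. x $ i = x $ (R F i)" using R[OF FE] unfolding retr_def by blast
        then have fc: "($) x \<in> fibre_const p (R F)" by (auto simp: fibre_const_def)
        have net: "\<bar>quad_form p (dev_matrix n (\<lambda>i. a i w) \<Sigma>) v\<bar> \<le> \<eta> s" if "v \<in> fibre_net p (R F)" for v
        proof -
          have "w \<notin> Ev s v" using w s that FE by (auto simp: Bad_def Cuts_def s_def)
          then show ?thesis using w by (simp add: Ev_def)
        qed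
        define N where "N = (\<Sum>i<p. (x $ i)\<^sup>2)"
        define q where "q = (\<Sum>i<n. (\<Sum>j<p. x $ j * a i w j)\<^sup>2) / real n"
        define Q where "Q = quad_form p (\<lambda>j k. \<Sigma> $$ (j, k)) (($) x)"
        have N0: "N \<ge> 0" and q0: "q \<ge> 0" by (auto simp: N_def q_def sum_nonneg)
        have Q: "(1 - \<kappa>)\<^sup>2 * N \<le> Q" "Q \<le> (1 + \<kappa>)\<^sup>2 * N"
          using sigma_min_le_quad_form[OF \<Sigma>c _ sym, of "($) x"] quad_form_le_sigma_max[OF \<Sigma>c _ sym, of "($) x"] p
            mult_right_mono[OF smin N0] mult_right_mono[OF smax N0]
          by (auto simp: N_def Q_def)
        have bs: "b s > 0" using b s by simp
        have "\<bar>q - Q\<bar> \<le> 3 * \<eta> s * N"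
          using quad_form_bound_from_net[OF net fc] by (simp add: quad_form_dev_matrix q_def Q_def N_def)
        also have "3 * \<eta> s * N = g * max (sqrt (b s)) ((sqrt (b s))\<^sup>2) * N"
          using bs by (simp add: \<eta>_def g_def)
        finally have dev: "\<bar>q - Q\<bar> \<le> g * max (sqrt (b s)) ((sqrt (b s))\<^sup>2) * N" .
        have "rho_log (c * H\<^sup>2) n E (real s) = H\<^sup>2 * b s"
          by (simp add: rho_log_def b_def m_def)
        then have rho: "sqrt (rho_log (c * H\<^sup>2) n E (real (grad_l0 E x))) = H * sqrt (b s)"
          using H s by (simp add: real_sqrt_mult)
        have nx: "l2_norm x = sqrt N" using l2_norm_eq[OF x] by (simp add: N_def)
        have "l2_norm (row_matrix n p a w *\<^sub>v x) = sqrt (\<Sum>i<n. (\<Sum>j<p. a i w j / sqrt (real n) * x $ j)\<^sup>2)"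
          unfolding l2_norm_mult_mat_vec[OF A x] by (simp add: row_matrix_def)
        also have "(\<Sum>i<n. (\<Sum>j<p. a i w j / sqrt (real n) * x $ j)\<^sup>2) = q"
          unfolding q_def sum_divide_distrib
        proof (intro sum.cong refl)
          fix i
          have "(\<Sum>j<p. a i w j / sqrt (real n) * x $ j) = (\<Sum>j<p. x $ j * a i w j) / sqrt (real n)"
            by (simp add: sum_divide_distrib mult.commute)
          then show "(\<Sum>j<p. a i w j / sqrt (real n) * x $ j)\<^sup>2 = (\<Sum>j<p. x $ j * a i w j)\<^sup>2 / real n"
            by (simp add: power_divide)
        qed
        finally have nAx: "l2_norm (row_matrix n p a w *\<^sub>v x) = sqrt q" .
        have "sqrt (b s) \<ge> 0" using bs by simp
        then show ?thesis
          unfolding rho nx nAx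
          using restricted_isometry_from_deviation[OF assms(2,3) g _ N0 q0 Q dev, folded H_def] by blast
      qed
      then show "cRIP n p E \<kappa> (rho_log (c * H\<^sup>2) n E) (row_matrix n p a w)"
        unfolding cRIP_def using A assms(2) crip by blast
    qed
    then have "prob (space M - Bad) \<le> prob ?good" using good by (intro finite_measure_mono)
    then show "prob ?good \<ge> 1 - real (card E) powr (- k)"
      using Bad Bad_sets by (simp add: prob_compl m_def)
  qed
qed

end
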